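(* Let $N\ge3$, $\alpha\in(0,N)$ and $p>\frac{N+\alpha}{N-2}$. There exists a sequence of functions $(u_n)_{n\in\mathbb N}$ in $C^\infty_c(\mathbb R^N)$ such that the supports $\operatorname{supp}(u_n)$ are uniformly bounded (contained in one bounded set), $(u_n)_{n\in\mathbb N}$ is bounded in $E^{\alpha,p}(\mathbb R^N)$, $u_n\to0$ almost everywhere and, if $\alpha\le2$ or $p\le\frac{2\alpha}{\alpha-2}$, $$\liminf_{n\to\infty}\int_{\mathbb R^N}|u_n|^{2\frac{2p+\alpha}{2+\alpha}}>0,$$ whereas if $\alpha>2$ and $p>\frac{2\alpha}{\alpha-2}$, $$\liminf_{n\to\infty}\int_{\mathbb R^N}|u_n|^p>0.$$
   Context: For $\alpha\in(0,N)$ the Riesz potential is $I_\alpha(x)=A_\alpha|x|^{-(N-\alpha)}$ for $x\in\mathbb R^N\setminus\{0\}$, with $A_\alpha=\frac{\Gamma((N-\alpha)/2)}{\Gamma(\alpha/2)\pi^{N/2}2^\alpha}$. For $p\ge1$, the Coulomb--Sobolev space $E^{\alpha,p}(\mathbb R^N)$ is the vector space of (a.e. classes of) measurable functions $u:\mathbb R^N\to\mathbb R$ with $\int_{\mathbb R^N}|I_{\alpha/2}*|u|^p|^2<\infty$ that are weakly differentiable with $Du\in L^2(\mathbb R^N)$, normed by $$\|u\|_{E^{\alpha,p}}=\Bigl(\int_{\mathbb R^N}|Du|^2+\Bigl(\int_{\mathbb R^N}\bigl|I_{\alpha/2}*|u|^p\bigr|^2\Bigr)^{1/p}\Bigr)^{1/2}.$$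 *)

theory Defs
  imports "HOL-Analysis.Analysis"
begin

definition riesz_const :: "nat \<Rightarrow> real \<Rightarrow> real" where
  "riesz_const N \<alpha> =
     Gamma ((real N - \<alpha>) / 2) / (Gamma (\<alpha> / 2) * pi powr (real N / 2) * 2 powr \<alpha>)"

text \<open>At the origin, where the kernel is left undefined on paper, this takes the value 0,
  because \<open>0 powr a = 0\<close>; the origin is a null set.\<close>

definition riesz_kernel :: "real \<Rightarrow> 'a::euclidean_space \<Rightarrow> real" where
  "riesz_kernel \<alpha> x = riesz_const DIM('a) \<alpha> * norm x powr (- (real DIM('a) - \<alpha>))"

text \<open>The convolution of the Riesz kernel with \<open>f\<close>, as a value in \<open>[0, \<infinity>]\<close>.  It is meant
  for nonnegative \<open>f\<close> only, since \<open>ennreal\<close> truncates negative values to 0.\<close>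

definition riesz_potential :: "real \<Rightarrow> ('a::euclidean_space \<Rightarrow> real) \<Rightarrow> 'a \<Rightarrow> ennreal" where
  "riesz_potential \<alpha> f x = (\<integral>\<^sup>+ y. ennreal (riesz_kernel \<alpha> (x - y) * f y) \<partial>lebesgue)"

definition coulomb_energy :: "real \<Rightarrow> real \<Rightarrow> ('a::euclidean_space \<Rightarrow> real) \<Rightarrow> ennreal" where
  "coulomb_energy \<alpha> p u =
     (\<integral>\<^sup>+ x. (riesz_potential (\<alpha> / 2) (\<lambda>y. \<bar>u y\<bar> powr p) x)\<^sup>2 \<partial>lebesgue)"

fun C_k :: "nat \<Rightarrow> ('a::euclidean_space \<Rightarrow> real) \<Rightarrow> bool" where
  "C_k 0 f \<longleftrightarrow> continuous_on UNIV f"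
| "C_k (Suc k) f \<longleftrightarrow>
     (\<forall>x. f differentiable (at x)) \<and> (\<forall>v. C_k k (\<lambda>x. frechet_derivative f (at x) v))"

definition smooth :: "('a::euclidean_space \<Rightarrow> real) \<Rightarrow> bool" where
  "smooth f \<longleftrightarrow> (\<forall>k. C_k k f)"

definition supp :: "('a::euclidean_space \<Rightarrow> real) \<Rightarrow> 'a set" where
  "supp f = closure (support_on UNIV f)"

definition C_c_inf :: "('a::euclidean_space \<Rightarrow> real) set" where
  "C_c_inf = {f. smooth f \<and> compact (supp f)}"

definition locally_integrable ::
    "('a::euclidean_space \<Rightarrow> 'b::{banach, second_countable_topology}) \<Rightarrow> bool" where
  "locally_integrable f \<longleftrightarrow> (\<forall>K. compact K \<longrightarrow> set_integrable lebesgue K f)"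

definition is_weak_gradient ::
    "('a::euclidean_space \<Rightarrow> real) \<Rightarrow> ('a \<Rightarrow> 'a) \<Rightarrow> bool" where
  "is_weak_gradient u g \<longleftrightarrow>
     locally_integrable u \<and> locally_integrable g \<and>
     (\<forall>\<phi>\<in>C_c_inf. \<forall>b\<in>Basis.
        (LINT x|lebesgue. u x * frechet_derivative \<phi> (at x) b) =
        - (LINT x|lebesgue. (g x \<bullet> b) * \<phi> x))"

definition weakly_differentiable :: "('a::euclidean_space \<Rightarrow> real) \<Rightarrow> bool" where
  "weakly_differentiable u \<longleftrightarrow> (\<exists>g. is_weak_gradient u g)"

text \<open>Weak gradients are unique only up to null sets, so this picks a representative.\<close>

definition weak_gradient :: "('a::euclidean_space \<Rightarrow> real) \<Rightarrow> 'a \<Rightarrow> 'a" where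
  "weak_gradient u = (SOME g. is_weak_gradient u g)"

text \<open>The elements are functions rather than classes of functions modulo null sets.\<close>

definition coulomb_sobolev :: "real \<Rightarrow> real \<Rightarrow> ('a::euclidean_space \<Rightarrow> real) set" where
  "coulomb_sobolev \<alpha> p =
     {u. u \<in> borel_measurable lebesgue \<and> coulomb_energy \<alpha> p u < \<infinity> \<and>
         weakly_differentiable u \<and>
         integrable lebesgue (\<lambda>x. (norm (weak_gradient u x))\<^sup>2)}"

text \<open>Meaningful only on \<open>coulomb_sobolev \<alpha> p\<close>: outside of it the two integrals may take
  their default value 0.\<close>

definition coulomb_sobolev_norm :: "real \<Rightarrow> real \<Rightarrow> ('a::euclidean_space \<Rightarrow> real) \<Rightarrow> real" where
  "coulomb_sobolev_norm \<alpha> p u =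
     sqrt ((LINT x|lebesgue. (norm (weak_gradient u x))\<^sup>2) +
           enn2real (coulomb_energy \<alpha> p u) powr (1 / p))"

definition bounded_in_coulomb_sobolev ::
    "real \<Rightarrow> real \<Rightarrow> (nat \<Rightarrow> 'a::euclidean_space \<Rightarrow> real) \<Rightarrow> bool" where
  "bounded_in_coulomb_sobolev \<alpha> p u \<longleftrightarrow>
     (\<forall>n. u n \<in> coulomb_sobolev \<alpha> p) \<and> (\<exists>C. \<forall>n. coulomb_sobolev_norm \<alpha> p (u n) \<le> C)"

end

theory Submission
  imports Defs
begin

text \<open>
  The sequence is made of clusters of tiny bumps. Let \<open>N\<close> be the dimension. Place
  \<open>M = k ^ N\<close> copies of one smooth bump, of height \<open>t\<close> and radius \<open>\<epsilon>\<close>, at the points of a grid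
  of mesh \<open>1 / k\<close> in the unit cube, and let \<open>k \<rightarrow> \<infinity>\<close>. If \<open>\<epsilon>\<close> is much smaller than the mesh,
  the bumps are disjoint and, up to constants:

  \<^item> the Dirichlet integral is of size \<open>M t\<^sup>2 \<epsilon> ^ (N - 2)\<close>,
  \<^item> the integral of the power \<open>q\<close> is of size \<open>M t ^ q \<epsilon> ^ N\<close>,
  \<^item> the Coulomb energy is at most the self-energy \<open>M t ^ (2 p) \<epsilon> ^ (N + \<alpha>)\<close> of the bumps plus
    the energy \<open>(M t ^ p \<epsilon> ^ N)\<^sup>2\<close> of their interaction. The interaction is no worse than that of
    a uniformly spread charge, because the centres are equidistributed.

  A single bump does not suffice: for \<open>p > (N + \<alpha>) / (N - 2)\<close> a bump of bounded Coulomb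
  energy has a Dirichlet integral and a \<open>q\<close>-integral that vanish as \<open>\<epsilon> \<rightarrow> 0\<close>, and this loss is
  compensated by letting the number of bumps grow. Put \<open>M = \<epsilon> ^ (- m)\<close> and \<open>t = \<epsilon> ^ (- \<tau>)\<close>.
  Then the bounds from above on the Dirichlet integral and the Coulomb energy, and from below on
  the \<open>q\<close>-integral, become linear conditions on \<open>m\<close> and \<open>\<tau>\<close>; this is \<open>concentrating_sequence_exists\<close>. In the first regime
  the Dirichlet integral, the self-energy and the \<open>q\<close>-integral all stay of order one, which determines
  \<open>m\<close>, \<open>\<tau>\<close> and \<open>q = 2 (2 p + \<alpha>) / (2 + \<alpha>)\<close>; the interaction stays bounded exactly when
  \<open>m \<le> N - \<alpha>\<close>, that is, when \<open>\<alpha> \<le> 2\<close> or \<open>p \<le> 2 \<alpha> / (\<alpha> - 2)\<close>. In the other regime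
  self-energy and interaction are the two quantities of order one, which gives \<open>m = N - \<alpha>\<close>,
  \<open>\<tau> = \<alpha> / p\<close> and \<open>q = p\<close>. In both regimes \<open>0 < m < N\<close>, so the supports have summable
  measure along \<open>k = 2 ^ n\<close> and the functions tend to 0 almost everywhere by Borel--Cantelli.

  Two ingredients need work. The Coulomb energy is rewritten as a double integral against the
  composition of the Riesz kernel with itself, which is bounded by a multiple of the kernel of order
  \<open>\<alpha>\<close> (\<open>riesz_kernel_composition_le\<close>); the potential of the union of the small balls is then bounded
  uniformly by comparing a far ball with the larger disjoint ball around the same centre
  (\<open>nn_integral_dist_powr_separated_balls_le\<close>). And since the Sobolev norm refers to an arbitrarily
  chosen weak gradient, weak gradients of smooth functions must be shown to agree almost everywhere with
  the classical one (\<open>weak_gradient_AE_eq_gradient\<close>), by the fundamental lemma of the calculus of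
  variations.
\<close>

section \<open>Calculus of smooth functions\<close>

lemma C_k_imp_continuous: "C_k k f \<Longrightarrow> continuous_on UNIV f"
proof (cases k)
  case (Suc j)
  moreover assume "C_k k f"
  ultimately have "isCont f x" for x by (simp add: differentiable_imp_continuous_within)
  then show ?thesis by (simp add: continuous_at_imp_continuous_on)
qed simp

lemma C_k_SucD: "C_k (Suc k) f \<Longrightarrow> C_k k f"
proof (induction k arbitrary: f)
  case 0
  from C_k_imp_continuous[OF this] show ?case by simp
next
  case (Suc k)
  then show ?case by (metis C_k.simps(2))
qed

lemma frechet_derivative_eqI: "(f has_derivative f') (at x) \<Longrightarrow> frechet_derivative f (at x) = f'"
  using frechet_derivative_at by metis

lemma C_k_SucI:
  assumes "\<And>x. (f has_derivative f' x) (at x)" "\<And>v. C_k k (\<lambda>x. f' x v)"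
  shows "C_k (Suc k) f"
  using assms frechet_derivative_eqI[OF assms(1)] by (auto simp: differentiable_def)

lemma C_k_const [simp]: "C_k k (\<lambda>x. c)"
proof (induction k arbitrary: c)
  case (Suc k)
  show ?case by (rule C_k_SucI[where f' = "\<lambda>x v. 0"]) (auto simp: Suc)
qed simp

lemma C_k_bounded_linear:
  assumes "bounded_linear f" shows "C_k k f"
proof (cases k)
  case 0
  then show ?thesis using assms by (simp add: linear_continuous_on)
next
  case (Suc j)
  show ?thesis unfolding Suc
    by (rule C_k_SucI[where f' = "\<lambda>x. f"]) (auto intro: bounded_linear_imp_has_derivative assms)
qed

lemma C_k_has_derivative:
  "C_k (Suc k) f \<Longrightarrow> (f has_derivative frechet_derivative f (at x)) (at x)"
  by (simp add: frechet_derivative_works)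

lemma C_k_add: "C_k k f \<Longrightarrow> C_k k g \<Longrightarrow> C_k k (\<lambda>x. f x + g x)"
proof (induction k arbitrary: f g)
  case 0
  then show ?case by (auto intro: continuous_on_add continuous_on_mult)
next
  case (Suc k)
  show ?case
    by (rule C_k_SucI[OF has_derivative_add[OF C_k_has_derivative C_k_has_derivative]])
       (use Suc in auto)
qed

text \<open>
  The induction hypothesis is applied to products of one factor with a derivative of the other, so
  the factors themselves must be known to have the lower regularity; this is where \<open>C_k_SucD\<close> enters.
\<close>

lemma C_k_mult: "C_k k f \<Longrightarrow> C_k k g \<Longrightarrow> C_k k (\<lambda>x. f x * g x)"
proof (induction k arbitrary: f g)
  case 0
  then show ?case by (auto intro: continuous_on_add continuous_on_mult)
next
  case (Suc k)
  note [simp del] = C_k.simps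
  have "C_k k (\<lambda>x. frechet_derivative f (at x) v)" "C_k k (\<lambda>x. frechet_derivative g (at x) v)"
    "C_k k f" "C_k k g" for v
    using Suc.prems C_k_SucD by (auto simp: C_k.simps)
  with Suc show ?case
    by (intro C_k_SucI[OF has_derivative_mult[OF C_k_has_derivative C_k_has_derivative]])
       (auto intro!: C_k_add)
qed

lemma smooth_const: "smooth (\<lambda>x. c)"
  by (simp add: smooth_def)

lemma smooth_bounded_linear: "bounded_linear f \<Longrightarrow> smooth f"
  by (simp add: smooth_def C_k_bounded_linear)

lemma smooth_add: "smooth f \<Longrightarrow> smooth g \<Longrightarrow> smooth (\<lambda>x. f x + g x)"
  by (simp add: smooth_def C_k_add)

lemma smooth_mult: "smooth f \<Longrightarrow> smooth g \<Longrightarrow> smooth (\<lambda>x. f x * g x)"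
  by (simp add: smooth_def C_k_mult)

lemma smooth_diff: "smooth f \<Longrightarrow> smooth g \<Longrightarrow> smooth (\<lambda>x. f x - g x)"
  using smooth_add[of f "\<lambda>x. (-1) * g x"] smooth_mult[OF smooth_const, of g "-1"] by simp

lemma smooth_sum: "(\<And>i. i \<in> I \<Longrightarrow> smooth (f i)) \<Longrightarrow> smooth (\<lambda>x. \<Sum>i\<in>I. f i x)"
  by (induction I rule: infinite_finite_induct) (auto intro: smooth_const smooth_add)

lemma smooth_prod: "(\<And>i. i \<in> I \<Longrightarrow> smooth (f i)) \<Longrightarrow> smooth (\<lambda>x. \<Prod>i\<in>I. f i x)"
  by (induction I rule: infinite_finite_induct) (auto intro: smooth_const smooth_mult)

lemma smooth_has_derivative:
  "smooth f \<Longrightarrow> (f has_derivative frechet_derivative f (at x)) (at x)"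
  unfolding smooth_def using C_k_has_derivative by blast

lemma smooth_continuous: "smooth f \<Longrightarrow> continuous_on UNIV f"
  unfolding smooth_def using C_k_imp_continuous by blast

lemma smooth_frechet_derivative: "smooth f \<Longrightarrow> smooth (\<lambda>x. frechet_derivative f (at x) v)"
  unfolding smooth_def using C_k.simps(2) by blast

section \<open>A smooth function that is flat at the origin\<close>

text \<open>
  The exponent \<open>j\<close> makes the family closed, up to linear combinations, under differentiation, which
  allows an induction over all its members at once; \<open>flat 0\<close> is the usual building block of bump
  functions.
\<close>

definition flat :: "nat \<Rightarrow> real \<Rightarrow> real" where
  "flat j s = (if s > 0 then (1 / s) ^ j * exp (- 1 / s) else 0)"

lemma flat_nonpos [simp]: "s \<le> 0 \<Longrightarrow> flat j s = 0"
  by (simp add: flat_def)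

lemma flat_nonneg [simp]: "flat j s \<ge> 0"
  by (simp add: flat_def)

lemma flat_0_le_1: "flat 0 s \<le> 1"
  by (simp add: flat_def)

text \<open>
  With \<open>y = 1 / s\<close> this is the decay of \<open>y ^ j * exp (- y)\<close> at infinity.
\<close>

lemma flat_tendsto_0: "(flat j \<longlongrightarrow> 0) (at 0)"
proof -
  have "((\<lambda>s. (1 / s) ^ j * exp (- (1 / s))) \<longlongrightarrow> 0) (at_right (0::real))"
  proof -
    have "((\<lambda>x::real. x ^ j / exp x) \<longlongrightarrow> 0) at_top" by (rule tendsto_power_div_exp_0)
    moreover have "filterlim (\<lambda>s::real. 1 / s) at_top (at_right 0)"
      using filterlim_inverse_at_top_right by (simp add: inverse_eq_divide)
    ultimately have "((\<lambda>s::real. (1 / s) ^ j / exp (1 / s)) \<longlongrightarrow> 0) (at_right 0)"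
      by (rule filterlim_compose)
    then show ?thesis by (simp add: exp_minus divide_inverse)
  qed
  then have "(flat j \<longlongrightarrow> 0) (at_right 0)"
    by (rule Lim_transform_eventually) (auto simp: flat_def eventually_at_right[of 0 1] intro!: exI[of _ 1])
  moreover have "(flat j \<longlongrightarrow> 0) (at_left 0)"
    by (rule Lim_transform_eventually[OF tendsto_const]) (auto simp: flat_def eventually_at_left[of "-1" 0] intro!: exI[of _ "-1"])
  ultimately show ?thesis by (simp add: filterlim_split_at)
qed

text \<open>
  At the origin the difference quotient of \<open>flat j\<close> is \<open>flat (j + 1)\<close>, which tends to 0.
\<close>

lemma flat_has_derivative:
  "(flat j has_real_derivative (flat (j + 2) s - real j * flat (j + 1) s)) (at s)"
proof -
  consider "s > 0" | "s < 0" | "s = 0" by linarith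
  then show ?thesis
  proof cases
    case 1
    have "((\<lambda>s. (1 / s) ^ j * exp (- 1 / s)) has_real_derivative
        (flat (j + 2) s - real j * flat (j + 1) s)) (at s)"
    proof -
      have D: "real j * (- (1 / s)\<^sup>2 * (1 / s) ^ (j - Suc 0)) = - real j * (1 / s) ^ (j + 1)"
        by (cases j) (simp_all add: power2_eq_square algebra_simps diff_divide_distrib add_divide_distrib)
      have "((\<lambda>s. 1 / s) has_real_derivative - (1 / s)\<^sup>2) (at s)"
        using DERIV_inverse[of s] 1 by (simp add: divide_inverse power2_eq_square)
      from DERIV_power[OF this, of j] DERIV_fun_exp[OF DERIV_minus[OF this]]
      have "((\<lambda>s. (1 / s) ^ j * exp (- (1 / s))) has_real_derivative
         (real j * (- (1 / s)\<^sup>2 * (1 / s) ^ (j - Suc 0))) * exp (- (1 / s)) +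
         (exp (- (1 / s)) * (- (- (1 / s)\<^sup>2))) * (1 / s) ^ j) (at s)" (is "(_ has_real_derivative ?D) _")
        by (rule DERIV_mult)
      moreover have "?D = flat (j + 2) s - real j * flat (j + 1) s"
        unfolding D using 1 by (simp add: flat_def power2_eq_square mult_ac)
      ultimately show ?thesis by (simp only: minus_divide_left)
    qed
    then show ?thesis
      by (rule has_field_derivative_transform_within_open[where S = "{0<..}"]) (use 1 in \<open>auto simp: flat_def\<close>)
  next
    case 2
    have "((\<lambda>s. 0) has_real_derivative (flat (j + 2) s - real j * flat (j + 1) s)) (at s)"
      using 2 by simp
    then show ?thesis
      by (rule has_field_derivative_transform_within_open[where S = "{..<0}"]) (use 2 in auto)
  next
    case 3
    have "(\<lambda>h. (flat j h - flat j 0) / (h - 0)) = (\<lambda>h. flat (j + 1) h)"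
      by (auto simp: fun_eq_iff flat_def field_simps)
    then show ?thesis
      using flat_tendsto_0[of "j + 1"] 3 by (simp add: has_field_derivative_iff)
  qed
qed

text \<open>
  The derivative of \<open>flat j \<circ> g\<close> is a combination of \<open>flat (j + 1) \<circ> g\<close> and
  \<open>flat (j + 2) \<circ> g\<close> with smooth coefficients, hence the induction on the order of
  differentiability has to treat all \<open>j\<close> simultaneously.
\<close>

lemma smooth_flat:
  assumes "smooth g" shows "smooth (\<lambda>x. flat j (g x))"
proof -
  have "C_k k (\<lambda>x. flat j (g x))" for k
  proof (induction k arbitrary: j)
    case 0
    have "continuous_on UNIV (flat j)"
      using flat_has_derivative DERIV_isCont continuous_at_imp_continuous_on by blast
    then show ?case
      using continuous_on_compose2[OF _ smooth_continuous[OF assms]] by fastforce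
  next
    case (Suc k)
    show ?case
    proof (rule C_k_SucI)
      show "((\<lambda>x. flat j (g x)) has_derivative
              (\<lambda>v. frechet_derivative g (at x) v * (flat (j + 2) (g x) - real j * flat (j + 1) (g x)))) (at x)" for x
        using has_derivative_compose[OF smooth_has_derivative[OF assms] flat_has_derivative[unfolded has_field_derivative_def]]
        by (simp add: mult.commute)
      have "C_k k (\<lambda>x. frechet_derivative g (at x) v * (flat (j + 2) (g x) + (- real j) * flat (j + 1) (g x)))" for v
        using smooth_frechet_derivative[OF assms, of v, unfolded smooth_def]
        by (intro C_k_mult C_k_add Suc.IH C_k_const) auto
      then show "C_k k (\<lambda>x. frechet_derivative g (at x) v * (flat (j + 2) (g x) - real j * flat (j + 1) (g x)))" for v
        by simp
    qed
  qed
  then show ?thesis by (simp add: smooth_def)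
qed

section \<open>Test functions and integration by parts\<close>

lemma zero_outside_supp: "x \<notin> supp f \<Longrightarrow> f x = 0"
  using closure_subset[of "support_on UNIV f"] by (auto simp: supp_def support_on_def)

lemma supp_subset: "closed K \<Longrightarrow> (\<And>x. x \<notin> K \<Longrightarrow> f x = 0) \<Longrightarrow> supp f \<subseteq> K"
  unfolding supp_def by (rule closure_minimal) (auto simp: support_on_def)

lemma C_c_infI:
  assumes "smooth f" "compact K" "\<And>x. x \<notin> K \<Longrightarrow> f x = 0"
  shows "f \<in> C_c_inf"
proof -
  have "K \<inter> supp f = supp f"
    using assms supp_subset[of K f] compact_imp_closed[of K] by auto
  then show ?thesis
    using assms compact_Int_closed[of K "supp f"] by (simp add: C_c_inf_def supp_def)
qed

lemma has_derivative_zero_outside: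
  assumes "(f has_derivative f') (at x)" "closed K" "x \<notin> K" "\<And>y. y \<notin> K \<Longrightarrow> f y = (0::real)"
  shows "f' = (\<lambda>v. 0)"
proof -
  have "(f has_derivative (\<lambda>v. 0)) (at x)"
    by (rule has_derivative_transform_within_open[of "\<lambda>x. 0" _ _ _ "- K"]) (use assms in auto)
  with assms(1) show ?thesis by (rule has_derivative_unique)
qed

lemma integrable_continuous_compact_support:
  fixes f :: "'a::euclidean_space \<Rightarrow> 'b::{banach, second_countable_topology}"
  assumes "continuous_on UNIV f" "compact K" "\<And>x. x \<notin> K \<Longrightarrow> f x = 0"
  shows "integrable lborel f"
proof -
  have "integrable lborel (\<lambda>x. indicator K x *\<^sub>R f x)"
    using assms borel_integrable_compact continuous_on_subset by blast
  also have "(\<lambda>x. indicator K x *\<^sub>R f x) = f"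
    using assms(3) by (auto simp: indicator_def)
  finally show ?thesis .
qed

lemma lborel_integral_translate:
  fixes f :: "'a::euclidean_space \<Rightarrow> real"
  assumes "f \<in> borel_measurable borel"
  shows "(\<integral>x. f (x + c) \<partial>lborel) = (\<integral>x. f x \<partial>lborel)"
proof -
  have "(\<integral>x. f x \<partial>lborel) = (\<integral>x. f x \<partial>distr lborel borel ((+) c))"
    by (simp add: lborel_distr_plus)
  also have "\<dots> = (\<integral>x. f (c + x) \<partial>lborel)"
    using assms by (intro integral_distr) auto
  finally show ?thesis by (simp add: add.commute)
qed

text \<open>
  By translation invariance every difference quotient in
  direction \<open>b\<close> has integral 0, and dominated convergence passes to the derivative. The
  mean value theorem provides the dominating function.
\<close>

lemma integral_directional_derivative_eq_0:
  fixes w :: "'a::euclidean_space \<Rightarrow> real"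
  assumes w: "\<And>x. (w has_derivative w' x) (at x)" and cont: "continuous_on UNIV (\<lambda>x. w' x b)"
    and K: "compact K" "\<And>x. x \<notin> K \<Longrightarrow> w x = 0"
  shows "(\<integral>x. w' x b \<partial>lborel) = 0"
proof -
  define q where "q = (\<lambda>n x. (w (x + inverse (real (Suc n)) *\<^sub>R b) - w x) / inverse (real (Suc n)))"
  have D0: "w' x b = 0" if "x \<notin> K" for x
  proof -
    have "w' x = (\<lambda>v. 0)"
      by (rule has_derivative_zero_outside[OF _ compact_imp_closed[OF K(1)] that]) (fact w K(2))+
    then show ?thesis by (rule fun_cong)
  qed
  have cw: "continuous_on UNIV w"
    by (intro continuous_at_imp_continuous_on ballI has_derivative_continuous[OF w])
  have [measurable]: "w \<in> borel_measurable borel" "(\<lambda>x. w' x b) \<in> borel_measurable borel"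
    using cw cont by (auto intro: borel_measurable_continuous_onI)
  have "bounded ((\<lambda>x. w' x b) ` K)"
    using K cont by (intro compact_imp_bounded compact_continuous_image) (auto intro: continuous_on_subset)
  then obtain B where B: "B > 0" "\<And>x. x \<in> K \<Longrightarrow> \<bar>w' x b\<bar> \<le> B"
    unfolding bounded_pos by auto
  have B: "B > 0" "\<And>x. \<bar>w' x b\<bar> \<le> B"
    using B D0 by (metis abs_zero less_le_not_le linorder_le_cases)+
  obtain R where R: "\<And>x. x \<in> K \<Longrightarrow> norm x \<le> R"
    using compact_imp_bounded[OF K(1)] unfolding bounded_iff by auto
  define K' where "K' = cball (0::'a) (R + norm b)"
  have iw: "integrable lborel w"
    by (rule integrable_continuous_compact_support[OF cw K])
  have iq: "(\<integral>x. q n x \<partial>lborel) = 0" for n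
  proof -
    let ?c = "inverse (real (Suc n)) *\<^sub>R b"
    have "(\<lambda>x. w (x + ?c)) = w \<circ> (+) ?c" by (auto simp: add.commute)
    then have "integrable lborel (\<lambda>x. w (x + ?c))"
      using iw integrable_distr_eq[of "(+) ?c" lborel borel w]
      by (simp add: lborel_distr_plus o_def)
    then show ?thesis
      using iw lborel_integral_translate[of w ?c] by (simp add: q_def)
  qed
  have "(\<lambda>n. \<integral>x. q n x \<partial>lborel) \<longlonglongrightarrow> (\<integral>x. w' x b \<partial>lborel)"
  proof (rule integral_dominated_convergence[where w = "\<lambda>x. B * indicator K' x"])
    have "emeasure lborel K' < \<infinity>"
      unfolding K'_def by (rule emeasure_lborel_cball_finite)
    then show "integrable lborel (\<lambda>x. B * indicator K' x)"
      by (intro integrable_mult_right integrable_real_indicator) (auto simp: K'_def)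
    have deriv: "((\<lambda>s. w (x + s *\<^sub>R b)) has_real_derivative w' (x + s *\<^sub>R b) b) (at s)" for x s
    proof -
      have "((\<lambda>s. x + s *\<^sub>R b) has_derivative (\<lambda>h. h *\<^sub>R b)) (at s)"
        by (auto intro!: derivative_eq_intros)
      from has_derivative_compose[OF this w]
      show ?thesis
        using linear_cmul[OF has_derivative_linear[OF w]]
        by (simp add: has_field_derivative_def mult_commute_abs)
    qed
    show "AE x in lborel. (\<lambda>n. q n x) \<longlonglongrightarrow> w' x b"
    proof (rule AE_I2)
      fix x
      have "((\<lambda>h. (w (x + h *\<^sub>R b) - w x) / h) \<longlongrightarrow> w' x b) (at 0)"
        using deriv[of x 0] by (simp add: has_field_derivative_iff)
      moreover have "filterlim (\<lambda>n. inverse (real (Suc n))) (at 0) sequentially"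
        using LIMSEQ_inverse_real_of_nat by (auto simp: filterlim_at)
      ultimately show "(\<lambda>n. q n x) \<longlonglongrightarrow> w' x b"
        unfolding q_def by (rule filterlim_compose)
    qed
    show "AE x in lborel. norm (q n x) \<le> B * indicator K' x" for n
    proof (rule AE_I2)
      fix x
      let ?h = "inverse (real (Suc n))"
      have h: "?h > 0" "?h \<le> 1" by (auto simp: field_simps)
      obtain z where z: "w (x + ?h *\<^sub>R b) - w (x + 0 *\<^sub>R b) = (?h - 0) * w' (x + z *\<^sub>R b) b"
        using MVT2[OF h(1) deriv] by blast
      have "\<bar>q n x\<bar> \<le> B" using z h B by (simp add: q_def)
      moreover have "q n x = 0" if "x \<notin> K'"
      proof -
        have "norm (?h *\<^sub>R b) \<le> norm b"
          using h by (simp add: mult_left_le_one_le)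
        moreover have "norm x > R + norm b" using that by (simp add: K'_def)
        moreover have "norm x \<le> norm (x + ?h *\<^sub>R b) + norm (?h *\<^sub>R b)"
          using norm_triangle_ineq4[of "x + ?h *\<^sub>R b" "?h *\<^sub>R b"] by simp
        ultimately have "norm (x + ?h *\<^sub>R b) > R" "norm x > R" using norm_ge_zero[of b] by linarith+
        then have "x + ?h *\<^sub>R b \<notin> K" "x \<notin> K" using R by (auto simp: not_le[symmetric])
        then show ?thesis using K(2) by (simp add: q_def)
      qed
      ultimately show "norm (q n x) \<le> B * indicator K' x" using B by (auto simp: indicator_def)
    qed
  qed (auto simp: q_def K'_def)
  then show ?thesis using iq by (simp add: LIMSEQ_const_iff)
qed

definition gradient :: "('a::euclidean_space \<Rightarrow> real) \<Rightarrow> 'a \<Rightarrow> 'a" where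
  "gradient u x = (\<Sum>b\<in>Basis. frechet_derivative u (at x) b *\<^sub>R b)"

lemma gradient_inner_Basis: "b \<in> Basis \<Longrightarrow> gradient u x \<bullet> b = frechet_derivative u (at x) b"
  by (simp add: gradient_def inner_sum_left_Basis)

lemma continuous_gradient: "smooth u \<Longrightarrow> continuous_on UNIV (gradient u)"
  unfolding gradient_def[abs_def]
  by (intro continuous_on_sum continuous_on_scaleR continuous_on_const smooth_continuous
      smooth_frechet_derivative)

lemma continuous_imp_locally_integrable:
  fixes f :: "'a::euclidean_space \<Rightarrow> 'b::{banach, second_countable_topology}"
  assumes "continuous_on UNIV f" shows "locally_integrable f"
  unfolding locally_integrable_def set_integrable_def
proof (intro allI impI)
  fix K :: "'a set" assume K: "compact K"
  have "integrable lborel (\<lambda>x. indicator K x *\<^sub>R f x)"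
    using borel_integrable_compact[OF K continuous_on_subset[OF assms]] by simp
  then show "integrable lebesgue (\<lambda>x. indicator K x *\<^sub>R f x)"
    by (simp add: integrable_completion borel_measurable_integrable)
qed

text \<open>
  Integration by parts is the vanishing of the integral of the directional derivative of the compactly
  supported product \<open>u * \<phi>\<close>.
\<close>

lemma gradient_is_weak_gradient:
  assumes u: "smooth u" shows "is_weak_gradient u (gradient u)"
  unfolding is_weak_gradient_def
proof (intro conjI ballI)
  show "locally_integrable u" "locally_integrable (gradient u)"
    using u by (auto intro: continuous_imp_locally_integrable smooth_continuous continuous_gradient)
  fix \<phi> :: "'a \<Rightarrow> real" and b :: 'a assume \<phi>: "\<phi> \<in> C_c_inf" and b: "b \<in> Basis"
  then have s: "smooth \<phi>" and K: "compact (supp \<phi>)" by (auto simp: C_c_inf_def)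
  let ?d\<phi> = "\<lambda>x. frechet_derivative \<phi> (at x) b" and ?du = "\<lambda>x. frechet_derivative u (at x) b"
  have c1: "continuous_on UNIV (\<lambda>x. u x * ?d\<phi> x)" and c2: "continuous_on UNIV (\<lambda>x. ?du x * \<phi> x)"
    using u s by (auto intro!: smooth_continuous smooth_mult smooth_frechet_derivative)
  have d0: "?d\<phi> x = 0" if "x \<notin> supp \<phi>" for x
    using has_derivative_zero_outside[OF smooth_has_derivative[OF s] compact_imp_closed[OF K] that]
      zero_outside_supp[of _ \<phi>] by simp
  have i1: "integrable lborel (\<lambda>x. u x * ?d\<phi> x)"
    by (rule integrable_continuous_compact_support[OF c1 K]) (simp add: d0)
  have i2: "integrable lborel (\<lambda>x. ?du x * \<phi> x)"
    by (rule integrable_continuous_compact_support[OF c2 K]) (simp add: zero_outside_supp)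
  have "(\<integral>x. u x * ?d\<phi> x + ?du x * \<phi> x \<partial>lborel) = 0"
    using integral_directional_derivative_eq_0[OF has_derivative_mult[OF smooth_has_derivative[OF u]
          smooth_has_derivative[OF s]] continuous_on_add[OF c1 c2] K] zero_outside_supp[of _ \<phi>]
    by simp
  then have "(\<integral>x. u x * ?d\<phi> x \<partial>lborel) = - (\<integral>x. ?du x * \<phi> x \<partial>lborel)"
    using i1 i2 by simp
  then show "(LINT x|lebesgue. u x * ?d\<phi> x) = - (LINT x|lebesgue. (gradient u x \<bullet> b) * \<phi> x)"
    using i1 i2 b by (simp add: integral_completion borel_measurable_integrable gradient_inner_Basis)
qed

section \<open>The fundamental lemma of the calculus of variations\<close>

lemma flat_0_scaled_tendsto:
  "(\<lambda>j. flat 0 (real (Suc j) * s)) \<longlonglongrightarrow> (if s > 0 then 1 else 0)"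
proof (cases "s > 0")
  case True
  have "(\<lambda>j. exp (- (inverse (real (Suc j)) * (1 / s)))) \<longlonglongrightarrow> exp (- (0 * (1 / s)))"
    by (intro tendsto_intros LIMSEQ_inverse_real_of_nat)
  moreover have "(\<lambda>j. exp (- (inverse (real (Suc j)) * (1 / s)))) = (\<lambda>j. flat 0 (real (Suc j) * s))"
    using True by (auto simp: flat_def fun_eq_iff divide_inverse zero_less_mult_iff simp del: of_nat_Suc)
  ultimately show ?thesis using True by simp
next
  case False
  then have "flat 0 (real (Suc j) * s) = 0" for j by (intro flat_nonpos mult_nonneg_nonpos) auto
  with False show ?thesis by simp
qed

text \<open>
  The indicator of an open box is the pointwise limit of test functions: on each side of the box,
  \<open>flat 0 ((j + 1) * s)\<close> tends to the indicator of \<open>s > 0\<close> as \<open>j \<rightarrow> \<infinity>\<close>.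
\<close>

lemma integral_box_eq_0_if_orthogonal_to_test_functions:
  fixes h :: "'a::euclidean_space \<Rightarrow> real"
  assumes h: "locally_integrable h" and orth: "\<And>\<phi>. \<phi> \<in> C_c_inf \<Longrightarrow> (LINT x|lebesgue. h x * \<phi> x) = 0"
  shows "(LINT x|lebesgue. h x * indicator (box a b) x) = 0"
proof -
  define \<phi> where "\<phi> = (\<lambda>j x. \<Prod>i\<in>Basis. flat 0 (real (Suc j) * (x \<bullet> i - a \<bullet> i)) * flat 0 (real (Suc j) * (b \<bullet> i - x \<bullet> i)))"
  have \<phi>0: "\<phi> j x = 0" if "x \<notin> cbox a b" for j x
  proof -
    obtain i where "i \<in> Basis" "x \<bullet> i < a \<bullet> i \<or> b \<bullet> i < x \<bullet> i"
      using \<open>x \<notin> cbox a b\<close> by (auto simp: mem_box not_le)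
    then show ?thesis unfolding \<phi>_def
      by (auto intro!: prod_zero bexI[of _ i] flat_nonpos mult_nonneg_nonpos)
  qed
  have \<phi>1: "0 \<le> \<phi> j x" "\<phi> j x \<le> 1" for j x
    unfolding \<phi>_def by (auto intro!: prod_nonneg prod_le_1 mult_le_one flat_0_le_1)
  have s: "smooth (\<phi> j)" for j
    unfolding \<phi>_def
    by (intro smooth_prod smooth_mult smooth_flat smooth_diff smooth_const smooth_bounded_linear
        bounded_linear_inner_left)
  have C: "\<phi> j \<in> C_c_inf" for j
    by (rule C_c_infI[OF s compact_cbox \<phi>0])
  have [measurable]: "\<phi> j \<in> borel_measurable lebesgue" for j
    using borel_measurable_continuous_onI[OF smooth_continuous[OF s[of j]]]
    by (simp add: measurable_completion)
  have hi: "integrable lebesgue (\<lambda>x. indicator (cbox a b) x *\<^sub>R h x)"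
    using h by (auto simp: locally_integrable_def set_integrable_def)
  have "(\<lambda>j. LINT x|lebesgue. \<phi> j x * (indicator (cbox a b) x *\<^sub>R h x)) \<longlonglongrightarrow> (LINT x|lebesgue. h x * indicator (box a b) x)"
  proof (rule integral_dominated_convergence[where w = "\<lambda>x. norm (indicator (cbox a b) x *\<^sub>R h x)"])
    show "integrable lebesgue (\<lambda>x. norm (indicator (cbox a b) x *\<^sub>R h x))"
      using hi by (rule integrable_norm)
    have [measurable]: "(\<lambda>x. indicator (cbox a b) x *\<^sub>R h x) \<in> borel_measurable lebesgue"
      using hi by (rule borel_measurable_integrable)
    show "(\<lambda>x. \<phi> j x * (indicator (cbox a b) x *\<^sub>R h x)) \<in> borel_measurable lebesgue" for j
      by measurable
    have "(\<lambda>x. h x * indicator (box a b) x) = (\<lambda>x. (indicator (cbox a b) x *\<^sub>R h x) * indicator (box a b) x)"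
      using box_subset_cbox[of a b] by (auto simp: indicator_def fun_eq_iff)
    also have "\<dots> \<in> borel_measurable lebesgue"
      using borel_measurable_integrable[OF hi]
      by (intro borel_measurable_times borel_measurable_indicator) auto
    finally show "(\<lambda>x. h x * indicator (box a b) x) \<in> borel_measurable lebesgue" .
    show "AE x in lebesgue. (\<lambda>j. \<phi> j x * (indicator (cbox a b) x *\<^sub>R h x)) \<longlonglongrightarrow> h x * indicator (box a b) x"
    proof (rule AE_I2)
      fix x
      have "(\<lambda>j. \<phi> j x) \<longlonglongrightarrow> (\<Prod>i\<in>Basis. (if x \<bullet> i - a \<bullet> i > 0 then 1 else 0) * (if b \<bullet> i - x \<bullet> i > 0 then 1 else 0))"
        unfolding \<phi>_def by (intro tendsto_prod tendsto_mult flat_0_scaled_tendsto)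
      also have "(\<Prod>i\<in>Basis. (if x \<bullet> i - a \<bullet> i > 0 then 1 else 0) * (if b \<bullet> i - x \<bullet> i > 0 then 1 else 0))
          = (indicator (box a b) x :: real)"
      proof (cases "x \<in> box a b")
        case False
        then show ?thesis by (fastforce simp: mem_box intro!: prod_zero)
      qed (auto simp: mem_box intro!: prod.neutral)
      finally have "(\<lambda>j. \<phi> j x * (indicator (cbox a b) x *\<^sub>R h x)) \<longlonglongrightarrow> indicator (box a b) x * (indicator (cbox a b) x *\<^sub>R h x)"
        by (rule tendsto_mult_right)
      also have "indicator (box a b) x * (indicator (cbox a b) x *\<^sub>R h x) = h x * indicator (box a b) x"
        using box_subset_cbox[of a b] by (auto simp: indicator_def)
      finally show "(\<lambda>j. \<phi> j x * (indicator (cbox a b) x *\<^sub>R h x)) \<longlonglongrightarrow> h x * indicator (box a b) x" .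
    qed
    show "AE x in lebesgue. norm (\<phi> j x * (indicator (cbox a b) x *\<^sub>R h x)) \<le> norm (indicator (cbox a b) x *\<^sub>R h x)" for j
      using \<phi>1[of j] by (auto simp: abs_mult intro!: mult_left_le_one_le)
  qed
  moreover have "\<phi> j x * (indicator (cbox a b) x *\<^sub>R h x) = h x * \<phi> j x" for j x
    using \<phi>0[of x j] by (auto simp: indicator_def)
  ultimately show ?thesis
    by (simp only: orth[OF C] LIMSEQ_const_iff)
qed

text \<open>
  Open boxes form an intersection-stable generator of the Borel sets, so the integral of \<open>H\<close>
  vanishes over all Borel sets by Dynkin's argument; replacing \<open>H\<close> by a Borel representative
  then gives the claim for the completed measure.
\<close>

lemma AE_eq_0_if_integral_box_eq_0:
  fixes H :: "'a::euclidean_space \<Rightarrow> real"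
  assumes H: "integrable lebesgue H" and total: "(LINT x|lebesgue. H x) = 0"
    and box: "\<And>a b. (LINT x:box a b|lebesgue. H x) = 0"
  shows "AE x in lebesgue. H x = 0"
proof -
  have setint: "set_integrable lebesgue A H" if "A \<in> sets lebesgue" for A
    using integrable_mult_indicator[OF that H] by (simp add: set_integrable_def)
  have borel: "(LINT x:A|lebesgue. H x) = 0" if "A \<in> sets borel" for A
  proof -
    have "Int_stable (range (\<lambda>(a, b). box a b :: 'a set))"
      by (auto simp: Int_stable_def box_Int_box)
    moreover have "range (\<lambda>(a, b). box a b :: 'a set) \<subseteq> Pow UNIV" by simp
    moreover have eq: "sigma_sets UNIV (range (\<lambda>(a, b). box a b :: 'a set)) = sets borel"
      by (simp add: borel_eq_box)
    then have "A \<in> sigma_sets UNIV (range (\<lambda>(a, b). box a b))" using that by simp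
    ultimately show ?thesis
    proof (induction rule: sigma_sets_induct_disjoint)
      case (basic A)
      then show ?case using box by auto
    next
      case empty
      then show ?case by (simp add: set_lebesgue_integral_def)
    next
      case (compl A)
      then have A: "A \<in> sets lebesgue" using eq by auto
      have "(LINT x:UNIV - A|lebesgue. H x) = (LINT x:UNIV|lebesgue. H x) - (LINT x:A|lebesgue. H x)"
        using set_integral_Un[of "UNIV - A" A lebesgue H] setint[of A] setint[of "UNIV - A"] A
        by (simp add: Diff_partition Un_commute sets.Diff Int_commute)
      then show ?case using compl total by (simp add: set_lebesgue_integral_def)
    next
      case (union A)
      then have A: "A i \<in> sets lebesgue" for i using eq by auto
      have "(LINT x:(\<Union>i. A i)|lebesgue. H x) = (\<Sum>i. (LINT x:A i|lebesgue. H x))"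
        using union(1) A setint
        by (intro lebesgue_integral_countable_add) (auto simp: disjoint_family_on_def)
      then show ?case using union by simp
    qed
  qed
  obtain g where g [measurable]: "g \<in> borel_measurable lborel" and Hg: "AE x in lborel. H x = g x"
    using completion_ex_borel_measurable_real[of H lborel] H by (auto dest: borel_measurable_integrable)
  have gc [measurable]: "g \<in> borel_measurable lebesgue" "H \<in> borel_measurable lebesgue"
    using g H by (auto intro: measurable_completion)
  have Hg': "AE x in lebesgue. H x = g x" using Hg by (rule AE_completion)
  have "integrable lebesgue g"
    using H integrable_cong_AE[OF _ _ Hg'] gc by simp
  then have int_g: "integrable lborel g" using g by (simp add: integrable_completion)
  have "AE x in lborel. g x = 0"
  proof (rule sigma_finite_measure.density_zero[OF sigma_finite_lborel int_g])
    fix A :: "'a set" assume A: "A \<in> sets lborel"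
    have "(LINT x:A|lborel. g x) = (LINT x:A|lebesgue. g x)"
      unfolding set_lebesgue_integral_def using A g by (intro integral_completion[symmetric]) auto
    also have "\<dots> = (LINT x:A|lebesgue. H x)"
      unfolding set_lebesgue_integral_def
      by (intro integral_cong_AE borel_measurable_scaleR borel_measurable_indicator gc)
         (use A Hg' in \<open>auto elim!: eventually_mono\<close>)
    finally show "(LINT x:A|lborel. g x) = 0" using borel[of A] A by simp
  qed
  then have "AE x in lborel. H x = 0" using Hg by eventually_elim simp
  then show ?thesis by (rule AE_completion)
qed

text \<open>
  Localisation to a bounded box turns local integrability into integrability.
\<close>

lemma fundamental_lemma_calculus_of_variations:
  fixes h :: "'a::euclidean_space \<Rightarrow> real"
  assumes h: "locally_integrable h" and orth: "\<And>\<phi>. \<phi> \<in> C_c_inf \<Longrightarrow> (LINT x|lebesgue. h x * \<phi> x) = 0"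
  shows "AE x in lebesgue. h x = 0"
proof -
  note box0 = integral_box_eq_0_if_orthogonal_to_test_functions[OF h orth]
  have "AE x in lebesgue. x \<in> box c d \<longrightarrow> h x = 0" for c d
  proof -
    have "integrable lebesgue (\<lambda>x. indicator (box c d) x *\<^sub>R (indicator (cbox c d) x *\<^sub>R h x))"
      by (rule integrable_mult_indicator) (use h in \<open>auto simp: locally_integrable_def set_integrable_def\<close>)
    moreover have "(\<lambda>x. indicator (box c d) x *\<^sub>R (indicator (cbox c d) x *\<^sub>R h x)) = (\<lambda>x. h x * indicator (box c d) x)"
      using box_subset_cbox[of c d] by (auto simp: indicator_def fun_eq_iff)
    ultimately have "integrable lebesgue (\<lambda>x. h x * indicator (box c d) x)" by (simp only:)
    moreover have "(LINT x:box a b|lebesgue. h x * indicator (box c d) x) = 0" for a b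
    proof -
      obtain a' b' where ab: "box a b \<inter> box c d = box a' b'" by (rule that[OF box_Int_box])
      have "(LINT x:box a b|lebesgue. h x * indicator (box c d) x) = (LINT x|lebesgue. h x * indicator (box a' b') x)"
        unfolding set_lebesgue_integral_def ab[symmetric]
        by (intro Bochner_Integration.integral_cong) (auto simp: indicator_def)
      then show ?thesis using box0 by simp
    qed
    ultimately have "AE x in lebesgue. h x * indicator (box c d) x = 0"
      using box0 by (intro AE_eq_0_if_integral_box_eq_0)
    then show ?thesis by (rule eventually_mono) (auto simp: indicator_def)
  qed
  then have "AE x in lebesgue. \<forall>n::nat. x \<in> box (- (real n *\<^sub>R One)) (real n *\<^sub>R One) \<longrightarrow> h x = 0"
    unfolding AE_all_countable by blast
  then show ?thesis
  proof (rule eventually_mono)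
    fix x :: 'a assume *: "\<forall>n::nat. x \<in> box (- (real n *\<^sub>R One)) (real n *\<^sub>R One) \<longrightarrow> h x = 0"
    have "x \<in> (\<Union>i::nat. box (- (real i *\<^sub>R One)) (real i *\<^sub>R One))" by (simp add: UN_box_eq_UNIV)
    with * show "h x = 0" by blast
  qed
qed

text \<open>
  The weak gradient is an arbitrary choice, so its relation to the classical gradient rests on the
  uniqueness almost everywhere of weak gradients, which is the fundamental lemma applied to each
  component of the difference of two of them.
\<close>

lemma weak_gradient_AE_eq_gradient:
  assumes u: "smooth u" shows "AE x in lebesgue. weak_gradient u x = gradient u x"
proof -
  have w: "is_weak_gradient u (weak_gradient u)"
    unfolding weak_gradient_def
    by (rule someI[of "is_weak_gradient u", OF gradient_is_weak_gradient[OF u]])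
  note g = gradient_is_weak_gradient[OF u]
  let ?h = "\<lambda>b x. (weak_gradient u x - gradient u x) \<bullet> b"
  have "AE x in lebesgue. ?h b x = 0" if b: "b \<in> Basis" for b
  proof (rule fundamental_lemma_calculus_of_variations)
    have li: "locally_integrable (\<lambda>x. f x \<bullet> b)" if "locally_integrable f" for f :: "'a \<Rightarrow> 'a"
      using that unfolding locally_integrable_def set_integrable_def
      by (auto dest!: spec intro: integrable_inner_left simp flip: inner_scaleR_left simp del: inner_scaleR_left)
    have l1: "locally_integrable (\<lambda>x. weak_gradient u x \<bullet> b)" and l2: "locally_integrable (\<lambda>x. gradient u x \<bullet> b)"
      using w g by (auto simp: is_weak_gradient_def intro: li)
    then show "locally_integrable (?h b)"
      unfolding locally_integrable_def inner_diff_left by (auto intro: set_integral_diff)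
    fix \<phi> :: "'a \<Rightarrow> real" assume \<phi>: "\<phi> \<in> C_c_inf"
    then have K: "compact (supp \<phi>)" and [measurable]: "\<phi> \<in> borel_measurable lebesgue"
      and c: "continuous_on UNIV \<phi>"
      using borel_measurable_continuous_onI[OF smooth_continuous, of \<phi>]
      by (auto simp: C_c_inf_def measurable_completion intro: smooth_continuous)
    obtain B where B: "\<And>x. x \<in> supp \<phi> \<Longrightarrow> \<bar>\<phi> x\<bar> \<le> B"
      using compact_imp_bounded[OF compact_continuous_image[OF continuous_on_subset[OF c] K]]
      unfolding bounded_iff by auto
    have int: "integrable lebesgue (\<lambda>x. f x * \<phi> x)" if f: "locally_integrable f" for f :: "'a \<Rightarrow> real"
    proof -
      have i: "integrable lebesgue (\<lambda>x. indicator (supp \<phi>) x *\<^sub>R f x)"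
        using f K by (auto simp: locally_integrable_def set_integrable_def)
      have [measurable]: "(\<lambda>x. indicator (supp \<phi>) x *\<^sub>R f x) \<in> borel_measurable lebesgue"
        using i by (rule borel_measurable_integrable)
      have eq: "(\<lambda>x. f x * \<phi> x) = (\<lambda>x. (indicator (supp \<phi>) x *\<^sub>R f x) * \<phi> x)"
        using zero_outside_supp[of _ \<phi>] by (auto simp: indicator_def fun_eq_iff)
      show ?thesis unfolding eq
      proof (rule Bochner_Integration.integrable_bound[OF integrable_mult_right[OF i, of B]])
        show "AE x in lebesgue. norm ((indicator (supp \<phi>) x *\<^sub>R f x) * \<phi> x) \<le> norm (B * (indicator (supp \<phi>) x *\<^sub>R f x))"
          using B by (force simp: indicator_def abs_mult mult.commute intro!: mult_right_mono)
      qed measurable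
    qed
    have "(LINT x|lebesgue. (weak_gradient u x \<bullet> b) * \<phi> x) = (LINT x|lebesgue. (gradient u x \<bullet> b) * \<phi> x)"
    proof -
      have "(LINT x|lebesgue. u x * frechet_derivative \<phi> (at x) b) = - (LINT x|lebesgue. (weak_gradient u x \<bullet> b) * \<phi> x)"
        using w \<phi> b unfolding is_weak_gradient_def by blast
      moreover have "(LINT x|lebesgue. u x * frechet_derivative \<phi> (at x) b) = - (LINT x|lebesgue. (gradient u x \<bullet> b) * \<phi> x)"
        using g \<phi> b unfolding is_weak_gradient_def by blast
      ultimately show ?thesis by simp
    qed
    then show "(LINT x|lebesgue. ?h b x * \<phi> x) = 0"
      using int[OF l1] int[OF l2] by (simp add: inner_diff_left left_diff_distrib)
  qed
  then have "AE x in lebesgue. \<forall>b\<in>Basis. ?h b x = 0"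
    by (intro AE_finite_allI finite_Basis)
  then show ?thesis
    by (rule eventually_mono) (auto simp: inner_diff_left intro: euclidean_eqI)
qed

section \<open>Integrals of powers of the norm\<close>

lemma nn_integral_lborel_affine:
  fixes t :: "'a::euclidean_space"
  assumes [measurable]: "f \<in> borel_measurable borel" and c: "c > 0"
  shows "(\<integral>\<^sup>+x. f x \<partial>lborel) = ennreal (c ^ DIM('a)) * (\<integral>\<^sup>+x. f (t + c *\<^sub>R x) \<partial>lborel)"
proof -
  have "(\<integral>\<^sup>+x. f x \<partial>lborel) = (\<integral>\<^sup>+x. f x \<partial>density (distr lborel borel (\<lambda>x. t + c *\<^sub>R x)) (\<lambda>_. \<bar>c\<bar> ^ DIM('a)))"
    using c by (intro arg_cong[where f = "\<lambda>M. nn_integral M f"] lborel_affine) auto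
  also have "\<dots> = ennreal (c ^ DIM('a)) * (\<integral>\<^sup>+x. f (t + c *\<^sub>R x) \<partial>lborel)"
    using c by (subst nn_integral_density) (auto simp: nn_integral_distr nn_integral_cmult)
  finally show ?thesis .
qed

lemma ennreal_le_suminf: "(f j :: ennreal) \<le> (\<Sum>i. f i)"
  using sum_le_suminf[of f "{j}"] by simp

text \<open>
  On the dyadic shell \<open>2 ^ (- j - 1) < norm x \<le> 2 ^ (- j)\<close> the integrand is at most
  \<open>2 ^ ((j + 1) s)\<close>, and the ball containing the shell has measure proportional to \<open>2 ^ (- j N)\<close>; the
  resulting geometric series converges because \<open>s < N\<close>.
\<close>

lemma nn_integral_norm_powr_near_0:
  fixes s :: real
  assumes "0 \<le> s" "s < DIM('a)"
  shows "(\<integral>\<^sup>+x. ennreal (norm x powr - s) * indicator (cball 0 1) x \<partial>(lborel::'a::euclidean_space measure)) < \<infinity>"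
proof -
  let ?N = "DIM('a)" and ?V = "unit_ball_vol (DIM('a))"
  let ?r = "2 powr (s - ?N)"
  let ?g = "\<lambda>j (x::'a). ennreal (2 powr (real (Suc j) * s)) * indicator (cball 0 ((1/2) ^ j)) x"
  have [measurable]: "cball (0::'a) r \<in> sets borel" for r by simp
  have pt: "ennreal (norm x powr - s) * indicator (cball 0 1) x \<le> (\<Sum>j. ?g j x)" for x :: 'a
  proof (cases "x \<in> cball 0 1 \<and> x \<noteq> 0")
    case True
    then have x: "norm x > 0" "norm x \<le> 1" by auto
    define k where "k = (LEAST k. (1/2::real) ^ k < norm x)"
    have "\<exists>k. (1/2::real) ^ k < norm x" using real_arch_pow_inv[of "norm x" "1/2"] x by simp
    then have k: "(1/2::real) ^ k < norm x" unfolding k_def by (rule LeastI_ex)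
    then have "k \<noteq> 0" using x by (cases k) auto
    then obtain j where j: "k = Suc j" by (cases k) auto
    have "\<not> (1/2::real) ^ j < norm x" using not_less_Least[of j "\<lambda>k. (1/2) ^ k < norm x"] j unfolding k_def by auto
    then have xj: "x \<in> cball 0 ((1/2) ^ j)" by simp
    have "norm x powr - s \<le> ((1/2) ^ k) powr - s"
      using k x assms by (intro powr_mono2') auto
    also have "\<dots> = 2 powr (real k * s)"
      by (simp add: powr_realpow[symmetric] powr_powr powr_divide powr_minus)
    finally have "ennreal (norm x powr - s) * indicator (cball 0 1) x \<le> ?g j x"
      using True xj j by (simp add: ennreal_leI)
    also have "\<dots> \<le> (\<Sum>j. ?g j x)" by (rule ennreal_le_suminf)
    finally show ?thesis .
  next
    case False
    then have "ennreal (norm x powr - s) * indicator (cball 0 1) x = 0"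
      by (auto simp: indicator_def)
    then show ?thesis by (simp only: zero_le)
  qed
  have "(\<integral>\<^sup>+x. ennreal (norm x powr - s) * indicator (cball 0 1) x \<partial>(lborel::'a measure)) \<le> (\<integral>\<^sup>+x. (\<Sum>j. ?g j x) \<partial>lborel)"
    by (intro nn_integral_mono pt)
  also have "\<dots> = (\<Sum>j. \<integral>\<^sup>+x. ?g j x \<partial>lborel)"
    by (rule nn_integral_suminf) measurable
  also have "(\<lambda>j. \<integral>\<^sup>+x. ?g j x \<partial>(lborel::'a measure)) = (\<lambda>j. ennreal (2 powr s * ?V * ?r ^ j))"
  proof
    fix j
    have "(\<integral>\<^sup>+x. ?g j x \<partial>(lborel::'a measure)) = ennreal (2 powr (real (Suc j) * s)) * ennreal (?V * ((1/2) ^ j) ^ ?N)"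
      by (simp add: nn_integral_cmult_indicator emeasure_cball)
    also have "\<dots> = ennreal (2 powr (real (Suc j) * s) * (?V * ((1/2) ^ j) ^ ?N))"
      by (simp add: ennreal_mult)
    also have "2 powr (real (Suc j) * s) * (?V * ((1/2) ^ j) ^ ?N) = 2 powr s * ?V * ?r ^ j"
    proof -
      have "?r ^ j = 2 powr (real j * s) * 2 powr (- (real j * ?N))"
        by (subst powr_add[symmetric]) (simp add: powr_power algebra_simps)
      moreover have "((1/2::real) ^ j) ^ ?N = 2 powr (- (real j * ?N))"
      proof -
        have "2 powr (- (real j * ?N)) = inverse (2 powr real (j * ?N))"
          by (simp only: powr_minus of_nat_mult)
        also have "\<dots> = inverse (2 ^ (j * ?N))" by (simp only: powr_realpow zero_less_numeral)
        finally show ?thesis by (simp only: power_mult power_inverse inverse_eq_divide power_one_over)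
      qed
      moreover have "2 powr (real (Suc j) * s) = 2 powr s * 2 powr (real j * s)"
        by (subst powr_add[symmetric]) (simp add: algebra_simps)
      ultimately show ?thesis by simp
    qed
    finally show "(\<integral>\<^sup>+x. ?g j x \<partial>(lborel::'a measure)) = ennreal (2 powr s * ?V * ?r ^ j)" .
  qed
  also have "(\<Sum>j. ennreal (2 powr s * ?V * ?r ^ j)) < \<infinity>"
  proof -
    have "?r < 1" using assms powr_less_mono[of "s - ?N" 0 2] by simp
    then have "summable (\<lambda>j. 2 powr s * ?V * ?r ^ j)"
      by (intro summable_mult summable_geometric) auto
    then show ?thesis by (subst suminf_ennreal2) auto
  qed
  finally show ?thesis .
qed

text \<open>
  The same dyadic argument with growing shells.
\<close>

lemma nn_integral_norm_powr_near_infinity: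
  fixes s :: real
  assumes "DIM('a) < s"
  shows "(\<integral>\<^sup>+x. ennreal (norm x powr - s) * indicator (- ball 0 1) x \<partial>(lborel::'a::euclidean_space measure)) < \<infinity>"
proof -
  let ?N = "DIM('a)" and ?V = "unit_ball_vol (DIM('a))"
  let ?r = "2 powr (?N - s)"
  let ?g = "\<lambda>j (x::'a). ennreal (2 powr (- real j * s)) * indicator (cball 0 (2 ^ Suc j)) x"
  have s: "s > 0" using assms by (meson less_trans of_nat_0_less_iff DIM_positive)
  have [measurable]: "cball (0::'a) r \<in> sets borel" for r by simp
  have pt: "ennreal (norm x powr - s) * indicator (- ball 0 1) x \<le> (\<Sum>j. ?g j x)" for x :: 'a
  proof (cases "x \<in> - ball 0 1")
    case True
    then have x: "norm x \<ge> 1" by auto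
    define k where "k = (LEAST k. norm x < 2 ^ k)"
    have "\<exists>k. norm x < 2 ^ k" using real_arch_pow[of 2 "norm x"] by simp
    then have k: "norm x < 2 ^ k" unfolding k_def by (rule LeastI_ex)
    then have "k \<noteq> 0" using x by (cases k) auto
    then obtain j where j: "k = Suc j" by (cases k) auto
    have nj: "\<not> norm x < 2 ^ j" using not_less_Least[of j "\<lambda>k. norm x < 2 ^ k"] j unfolding k_def by auto
    have xj: "x \<in> cball 0 (2 ^ Suc j)" using k j by simp
    have "norm x powr - s \<le> (2 ^ j) powr - s"
      using nj x s by (intro powr_mono2') auto
    also have "\<dots> = 2 powr (- real j * s)"
      by (simp add: powr_realpow[symmetric] powr_powr)
    finally have "ennreal (norm x powr - s) * indicator (- ball 0 1) x \<le> ?g j x"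
      using True xj j by (simp add: ennreal_leI)
    also have "\<dots> \<le> (\<Sum>j. ?g j x)" by (rule ennreal_le_suminf)
    finally show ?thesis .
  next
    case False
    then have "ennreal (norm x powr - s) * indicator (- ball 0 1) x = 0"
      by (auto simp: indicator_def)
    then show ?thesis by (simp only: zero_le)
  qed
  have "(\<integral>\<^sup>+x. ennreal (norm x powr - s) * indicator (- ball 0 1) x \<partial>(lborel::'a measure)) \<le> (\<integral>\<^sup>+x. (\<Sum>j. ?g j x) \<partial>lborel)"
    by (intro nn_integral_mono pt)
  also have "\<dots> = (\<Sum>j. \<integral>\<^sup>+x. ?g j x \<partial>lborel)"
    by (rule nn_integral_suminf) measurable
  also have "(\<lambda>j. \<integral>\<^sup>+x. ?g j x \<partial>(lborel::'a measure)) = (\<lambda>j. ennreal (2 ^ ?N * ?V * ?r ^ j))"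
  proof
    fix j
    have "(\<integral>\<^sup>+x. ?g j x \<partial>(lborel::'a measure)) = ennreal (2 powr (- real j * s)) * ennreal (?V * (2 ^ Suc j) ^ ?N)"
      by (simp add: nn_integral_cmult_indicator emeasure_cball del: power_Suc)
    also have "\<dots> = ennreal (2 powr (- real j * s) * (?V * (2 ^ Suc j) ^ ?N))"
      by (simp add: ennreal_mult)
    also have "2 powr (- real j * s) * (?V * (2 ^ Suc j) ^ ?N) = 2 ^ ?N * ?V * ?r ^ j"
    proof -
      have "?r ^ j = 2 powr (- real j * s) * 2 powr (real j * ?N)"
        by (subst powr_add[symmetric]) (simp add: powr_power algebra_simps)
      moreover have "((2::real) ^ Suc j) ^ ?N = 2 ^ ?N * 2 powr (real j * ?N)"
        using powr_realpow[of 2 "j * ?N"] by (simp add: power_mult power_mult_distrib)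
      ultimately show ?thesis by simp
    qed
    finally show "(\<integral>\<^sup>+x. ?g j x \<partial>(lborel::'a measure)) = ennreal (2 ^ ?N * ?V * ?r ^ j)" .
  qed
  also have "(\<Sum>j. ennreal (2 ^ ?N * ?V * ?r ^ j)) < \<infinity>"
  proof -
    have "?r < 1" using assms powr_less_mono[of "?N - s" 0 2] by simp
    then have "summable (\<lambda>j. 2 ^ ?N * ?V * ?r ^ j)"
      by (intro summable_mult summable_geometric) auto
    then show ?thesis by (subst suminf_ennreal2) auto
  qed
  finally show ?thesis .
qed

text \<open>
  The kernel is at most 1 at distance more than 1 from \<open>y\<close>, and within distance 1 its integral does
  not depend on \<open>y\<close>.
\<close>

lemma nn_integral_dist_powr_le_const_plus_measure:
  fixes s :: real
  assumes "0 \<le> s" "s < DIM('a)"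
  obtains C :: real where "C \<ge> 0" "\<And>(y::'a::euclidean_space) A. A \<in> sets borel \<Longrightarrow>
      (\<integral>\<^sup>+w. ennreal (norm (y - w) powr - s) * indicator A w \<partial>lborel) \<le> ennreal C + emeasure lborel A"
proof -
  let ?I = "\<integral>\<^sup>+x. ennreal (norm x powr - s) * indicator (cball 0 1) x \<partial>(lborel::'a measure)"
  obtain C where C: "C \<ge> 0" "?I = ennreal C"
    using nn_integral_norm_powr_near_0[OF assms] by (cases ?I) (auto simp: top_unique)
  show thesis
  proof (rule that[OF C(1)])
    fix y :: 'a and A :: "'a set" assume [measurable]: "A \<in> sets borel"
    have [measurable]: "cball (0::'a) 1 \<in> sets borel" by simp
    have "(\<integral>\<^sup>+w. ennreal (norm (y - w) powr - s) * indicator A w \<partial>lborel) \<le>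
      (\<integral>\<^sup>+w. ennreal (norm (w - y) powr - s) * indicator (cball 0 1) (w - y) + indicator A w \<partial>lborel)"
    proof (intro nn_integral_mono)
      fix w
      show "ennreal (norm (y - w) powr - s) * indicator A w \<le>
          ennreal (norm (w - y) powr - s) * indicator (cball 0 1) (w - y) + indicator A w"
      proof (cases "norm (w - y) \<le> 1")
        case False
        then have "norm (w - y) powr - s \<le> 1 powr - s"
          using assms by (intro powr_mono2') auto
        then show ?thesis using False by (auto simp: indicator_def norm_minus_commute)
      qed (auto simp: indicator_def norm_minus_commute)
    qed
    also have "\<dots> = (\<integral>\<^sup>+w. ennreal (norm (w - y) powr - s) * indicator (cball 0 1) (w - y) \<partial>lborel) + emeasure lborel A"
      by (subst nn_integral_add) simp_all
    also have "(\<integral>\<^sup>+w. ennreal (norm (w - y) powr - s) * indicator (cball 0 1) (w - y) \<partial>lborel) = ?I"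
      by (subst nn_integral_lborel_affine[where t = y and c = 1]) auto
    finally show "(\<integral>\<^sup>+w. ennreal (norm (y - w) powr - s) * indicator A w \<partial>lborel) \<le> ennreal C + emeasure lborel A"
      using C by simp
  qed
qed

text \<open>
  By scaling, the case of radius 1 of \<open>nn_integral_dist_powr_le_const_plus_measure\<close> suffices.
\<close>

lemma nn_integral_dist_powr_cball_le:
  fixes s :: real
  assumes "0 \<le> s" "s < DIM('a)"
  obtains C :: real where "C \<ge> 0" "\<And>(y::'a::euclidean_space) z \<epsilon>. \<epsilon> > 0 \<Longrightarrow>
      (\<integral>\<^sup>+w. ennreal (norm (y - w) powr - s) * indicator (cball z \<epsilon>) w \<partial>lborel) \<le> ennreal (C * \<epsilon> powr (DIM('a) - s))"
proof -
  obtain D :: real where D: "D \<ge> 0" "\<And>(y::'a) A. A \<in> sets borel \<Longrightarrow>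
      (\<integral>\<^sup>+w. ennreal (norm (y - w) powr - s) * indicator A w \<partial>lborel) \<le> ennreal D + emeasure lborel A"
    using nn_integral_dist_powr_le_const_plus_measure[OF assms] by blast
  let ?V = "unit_ball_vol DIM('a)"
  show thesis
  proof (rule that[of "D + ?V"])
    show "D + ?V \<ge> 0" using D by simp
    fix y z :: 'a and \<epsilon> :: real assume e: "\<epsilon> > 0"
    have [measurable]: "cball z \<epsilon> \<in> sets borel" "cball (0::'a) 1 \<in> sets borel" by simp_all
    have "(\<integral>\<^sup>+w. ennreal (norm (y - w) powr - s) * indicator (cball z \<epsilon>) w \<partial>lborel) =
      ennreal (\<epsilon> ^ DIM('a)) * (\<integral>\<^sup>+w. ennreal (norm (y - (z + \<epsilon> *\<^sub>R w)) powr - s) * indicator (cball z \<epsilon>) (z + \<epsilon> *\<^sub>R w) \<partial>lborel)"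
      by (rule nn_integral_lborel_affine[OF _ e]) measurable
    also have "(\<lambda>w. ennreal (norm (y - (z + \<epsilon> *\<^sub>R w)) powr - s) * indicator (cball z \<epsilon>) (z + \<epsilon> *\<^sub>R w)) =
       (\<lambda>w. ennreal (\<epsilon> powr - s) * (ennreal (norm ((y - z) /\<^sub>R \<epsilon> - w) powr - s) * indicator (cball 0 1) w))"
    proof
      fix w
      have "y - (z + \<epsilon> *\<^sub>R w) = \<epsilon> *\<^sub>R ((y - z) /\<^sub>R \<epsilon> - w)"
        using e by (simp add: algebra_simps)
      then have "norm (y - (z + \<epsilon> *\<^sub>R w)) powr - s = \<epsilon> powr - s * norm ((y - z) /\<^sub>R \<epsilon> - w) powr - s"
        using e by (simp only: norm_scaleR powr_mult abs_of_pos norm_ge_zero)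
      moreover have "indicator (cball z \<epsilon>) (z + \<epsilon> *\<^sub>R w) = (indicator (cball 0 1) w :: ennreal)"
        using e by (simp add: indicator_def dist_norm)
      ultimately show "ennreal (norm (y - (z + \<epsilon> *\<^sub>R w)) powr - s) * indicator (cball z \<epsilon>) (z + \<epsilon> *\<^sub>R w) =
        ennreal (\<epsilon> powr - s) * (ennreal (norm ((y - z) /\<^sub>R \<epsilon> - w) powr - s) * indicator (cball 0 1) w)"
        by (simp only: ennreal_mult powr_ge_zero mult.assoc)
    qed
    also have "ennreal (\<epsilon> ^ DIM('a)) * (\<integral>\<^sup>+w. ennreal (\<epsilon> powr - s) * (ennreal (norm ((y - z) /\<^sub>R \<epsilon> - w) powr - s) * indicator (cball 0 1) w) \<partial>lborel)
      = ennreal (\<epsilon> ^ DIM('a)) * (ennreal (\<epsilon> powr - s) * (\<integral>\<^sup>+w. ennreal (norm ((y - z) /\<^sub>R \<epsilon> - w) powr - s) * indicator (cball 0 1) w \<partial>lborel))"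
      by (subst nn_integral_cmult) auto
    also have "\<dots> \<le> ennreal (\<epsilon> ^ DIM('a)) * (ennreal (\<epsilon> powr - s) * (ennreal D + ennreal ?V))"
      using D(2)[of "cball 0 1" "(y - z) /\<^sub>R \<epsilon>"] emeasure_cball[of 1 "0::'a"]
      by (intro mult_left_mono) auto
    also have "\<dots> = ennreal ((D + ?V) * (\<epsilon> ^ DIM('a) * \<epsilon> powr - s))"
      using D e by (simp add: ennreal_mult[symmetric] ennreal_plus[symmetric] mult_ac del: ennreal_plus)
    also have "\<epsilon> ^ DIM('a) * \<epsilon> powr - s = \<epsilon> powr (DIM('a) - s)"
      using e by (simp add: powr_realpow[symmetric] powr_add[symmetric])
    finally show "(\<integral>\<^sup>+w. ennreal (norm (y - w) powr - s) * indicator (cball z \<epsilon>) w \<partial>lborel)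
      \<le> ennreal ((D + ?V) * \<epsilon> powr (DIM('a) - s))" .
  qed
qed

section \<open>Composition of Riesz kernels and potentials of separated balls\<close>

text \<open>
  This is the upper bound in the semigroup property of Riesz potentials. Let
  \<open>\<rho> = norm (y - z) / 2\<close>. At each \<open>x\<close> the larger of the distances to \<open>y\<close> and \<open>z\<close> is at least
  \<open>\<rho>\<close> and at least the smaller one, so the product of the two kernels is at most
  \<open>g \<rho> (x - y) + g \<rho> (x - z)\<close> with \<open>g \<rho> v = norm v powr - a * max (norm v) \<rho> powr - a\<close>.
  The function \<open>g 1\<close> is integrable, near 0 because \<open>a < N\<close> and at infinity because \<open>2 a > N\<close>, and
  scaling gives the dependence on \<open>\<rho>\<close>.
\<close>

lemma riesz_kernel_composition_le:
  fixes a :: real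
  assumes a: "DIM('a) / 2 < a" "a < DIM('a)"
  obtains C :: real where "C \<ge> 0" "\<And>y z :: 'a::euclidean_space. y \<noteq> z \<Longrightarrow>
      (\<integral>\<^sup>+x. ennreal (norm (x - y) powr - a * norm (x - z) powr - a) \<partial>lborel)
        \<le> ennreal (C * norm (y - z) powr - (2 * a - DIM('a)))"
proof -
  have a0: "a > 0" using a(1) by (meson divide_nonneg_pos le_less_trans of_nat_0_le_iff zero_less_numeral)
  define g :: "real \<Rightarrow> 'a \<Rightarrow> real" where "g = (\<lambda>\<rho> x. norm x powr - a * max (norm x) \<rho> powr - a)"
  have [measurable]: "cball (0::'a) 1 \<in> sets borel" by simp
  have [measurable]: "g \<rho> \<in> borel_measurable borel" for \<rho> unfolding g_def by measurable
  have "(\<integral>\<^sup>+x. ennreal (g 1 x) \<partial>lborel) \<le>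
     (\<integral>\<^sup>+x. ennreal (norm x powr - a) * indicator (cball 0 1) x + ennreal (norm x powr - (2 * a)) * indicator (- ball 0 1) x \<partial>(lborel::'a measure))"
  proof (rule nn_integral_mono)
    fix x :: 'a
    show "ennreal (g 1 x) \<le> ennreal (norm x powr - a) * indicator (cball 0 1) x + ennreal (norm x powr - (2 * a)) * indicator (- ball 0 1) x"
    proof (cases "norm x \<le> 1")
      case False
      then have "g 1 x = norm x powr - (2 * a)"
        by (simp add: g_def max_def powr_add[symmetric])
      then show ?thesis using False by (simp add: indicator_def)
    qed (simp add: g_def max_def indicator_def)
  qed
  also have "\<dots> = (\<integral>\<^sup>+x. ennreal (norm x powr - a) * indicator (cball 0 1) x \<partial>(lborel::'a measure)) +
      (\<integral>\<^sup>+x. ennreal (norm x powr - (2 * a)) * indicator (- ball 0 1) x \<partial>(lborel::'a measure))"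
    by (rule nn_integral_add) auto
  also have "\<dots> < \<infinity>"
    using nn_integral_norm_powr_near_0[of a, where 'a = 'a] nn_integral_norm_powr_near_infinity[of "2 * a", where 'a = 'a] a a0
    by simp
  finally obtain C where C: "C \<ge> 0" "(\<integral>\<^sup>+x. ennreal (g 1 x) \<partial>lborel) = ennreal C"
    by (cases "\<integral>\<^sup>+x. ennreal (g 1 x) \<partial>lborel") (auto simp: top_unique)
  have scale: "(\<integral>\<^sup>+x. ennreal (g \<rho> (x - y)) \<partial>lborel) = ennreal (\<rho> powr (DIM('a) - 2 * a) * C)" if \<rho>: "\<rho> > 0" for \<rho> y
  proof -
    have "(\<integral>\<^sup>+x. ennreal (g \<rho> (x - y)) \<partial>lborel) =
      ennreal (\<rho> ^ DIM('a)) * (\<integral>\<^sup>+x. ennreal (g \<rho> (y + \<rho> *\<^sub>R x - y)) \<partial>lborel)"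
      by (rule nn_integral_lborel_affine[OF _ \<rho>]) measurable
    also have "(\<lambda>x. ennreal (g \<rho> (y + \<rho> *\<^sub>R x - y))) = (\<lambda>x. ennreal (\<rho> powr - (2 * a)) * ennreal (g 1 x))"
    proof
      fix x :: 'a
      have "max (\<rho> * norm x) \<rho> = \<rho> * max (norm x) 1"
        using \<rho> by (simp add: max_def)
      then have "g \<rho> (\<rho> *\<^sub>R x) = (\<rho> powr - a * \<rho> powr - a) * g 1 x"
        using \<rho> by (simp add: g_def powr_mult mult_ac)
      then show "ennreal (g \<rho> (y + \<rho> *\<^sub>R x - y)) = ennreal (\<rho> powr - (2 * a)) * ennreal (g 1 x)"
        by (simp add: powr_add[symmetric] ennreal_mult' )
    qed
    also have "(\<integral>\<^sup>+x. ennreal (\<rho> powr - (2 * a)) * ennreal (g 1 x) \<partial>lborel) = ennreal (\<rho> powr - (2 * a)) * ennreal C"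
      by (subst nn_integral_cmult) (auto simp: C)
    also have "ennreal (\<rho> ^ DIM('a)) * (ennreal (\<rho> powr - (2 * a)) * ennreal C) = ennreal (\<rho> powr (DIM('a) - 2 * a) * C)"
      using \<rho> C by (simp add: ennreal_mult[symmetric] powr_realpow[symmetric] powr_diff powr_minus divide_inverse mult_ac)
    finally show ?thesis .
  qed
  let ?s = "2 * a - DIM('a)"
  show thesis
  proof (rule that[of "2 * (2 powr ?s * C)"])
    show "2 * (2 powr ?s * C) \<ge> 0" using C by simp
    fix y z :: 'a assume yz: "y \<noteq> z"
    define \<rho> where "\<rho> = norm (y - z) / 2"
    have \<rho>: "\<rho> > 0" using yz by (simp add: \<rho>_def)
    have pt: "norm (x - y) powr - a * norm (x - z) powr - a \<le> g \<rho> (x - y) + g \<rho> (x - z)" for x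
    proof -
      have tri: "2 * \<rho> \<le> norm (x - y) + norm (x - z)"
        using norm_triangle_ineq4[of "x - z" "x - y"] by (simp add: \<rho>_def)
      have key: "norm (x - v) powr - a * norm (x - w) powr - a \<le> g \<rho> (x - v)"
        if "norm (x - v) \<le> norm (x - w)" "2 * \<rho> \<le> norm (x - v) + norm (x - w)" for v w
        unfolding g_def using that \<rho> a0
        by (intro mult_left_mono powr_mono2') auto
      have nn: "g \<rho> v \<ge> 0" for v by (simp add: g_def)
      show ?thesis
      proof (cases "norm (x - y) \<le> norm (x - z)")
        case True
        then show ?thesis using key[of y z] tri nn[of "x - z"] by linarith
      next
        case False
        then show ?thesis using key[of z y] tri nn[of "x - y"] by (simp add: mult.commute add.commute)
      qed
    qed
    have "(\<integral>\<^sup>+x. ennreal (norm (x - y) powr - a * norm (x - z) powr - a) \<partial>lborel)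
      \<le> (\<integral>\<^sup>+x. ennreal (g \<rho> (x - y)) + ennreal (g \<rho> (x - z)) \<partial>lborel)"
    proof (rule nn_integral_mono)
      fix x
      have nn: "g \<rho> v \<ge> 0" for v by (simp add: g_def)
      show "ennreal (norm (x - y) powr - a * norm (x - z) powr - a) \<le> ennreal (g \<rho> (x - y)) + ennreal (g \<rho> (x - z))"
        using pt[of x] nn by (simp add: ennreal_plus[symmetric] ennreal_leI del: ennreal_plus)
    qed
    also have "\<dots> = ennreal (\<rho> powr (DIM('a) - 2 * a) * C) + ennreal (\<rho> powr (DIM('a) - 2 * a) * C)"
      by (subst nn_integral_add) (auto simp: scale[OF \<rho>])
    also have "\<dots> = ennreal (2 * (\<rho> powr - ?s * C))"
      using C by (simp add: ennreal_plus[symmetric] del: ennreal_plus)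
    also have "\<rho> powr - ?s = 2 powr ?s * norm (y - z) powr - ?s"
      by (simp add: \<rho>_def powr_divide powr_minus powr_diff field_simps)
    finally show "(\<integral>\<^sup>+x. ennreal (norm (x - y) powr - a * norm (x - z) powr - a) \<partial>lborel)
        \<le> ennreal (2 * (2 powr ?s * C) * norm (y - z) powr - ?s)"
      by (simp add: mult_ac)
  qed
qed

lemma disjoint_family_on_balls:
  fixes F :: "'a::real_normed_vector set"
  assumes sep: "\<And>z z'. z \<in> F \<Longrightarrow> z' \<in> F \<Longrightarrow> z \<noteq> z' \<Longrightarrow> 2 * \<delta> \<le> norm (z - z')"
  shows "disjoint_family_on (\<lambda>z. ball z \<delta>) F"
  unfolding disjoint_family_on_def
proof (intro ballI impI)
  fix z z' assume zz: "z \<in> F" "z' \<in> F" "z \<noteq> z'"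
  show "ball z \<delta> \<inter> ball z' \<delta> = {}"
  proof (rule ccontr)
    assume "ball z \<delta> \<inter> ball z' \<delta> \<noteq> {}"
    then obtain w where "dist z w < \<delta>" "dist z' w < \<delta>" by auto
    then have "norm (z - z') < 2 * \<delta>"
      using dist_triangle3[of z z' w] by (simp add: dist_norm norm_minus_commute)
    then show False using sep[OF zz] by simp
  qed
qed

text \<open>
  The first term on the right accounts for the balls near \<open>y\<close>: at most \<open>3 ^ N\<close> centres are
  within \<open>2 \<delta>\<close> of \<open>y\<close>, because the disjoint \<open>\<delta>\<close>-balls around them fit into a ball of radius
  \<open>3 \<delta>\<close>. For any other centre the kernel varies only by a constant factor on the \<open>\<delta>\<close>-ball, so
  shrinking this ball to radius \<open>\<epsilon>\<close> reduces the integral by the ratio of the volumes;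
  the integral over all the disjoint \<open>\<delta>\<close>-balls is bounded, since they lie in a fixed ball.
\<close>

lemma nn_integral_dist_powr_separated_balls_le:
  fixes s R :: real
  assumes s: "0 \<le> s" "s < DIM('a)"
  obtains C :: real where "C \<ge> 0" "\<And>(y::'a::euclidean_space) F \<epsilon> \<delta>.
      finite F \<Longrightarrow> F \<subseteq> cball 0 R \<Longrightarrow> 0 < \<epsilon> \<Longrightarrow> \<epsilon> \<le> \<delta> \<Longrightarrow> \<delta> \<le> 1 \<Longrightarrow>
      (\<And>z z'. z \<in> F \<Longrightarrow> z' \<in> F \<Longrightarrow> z \<noteq> z' \<Longrightarrow> 2 * \<delta> \<le> norm (z - z')) \<Longrightarrow>
      (\<integral>\<^sup>+w. ennreal (norm (y - w) powr - s) * indicator (\<Union>z\<in>F. cball z \<epsilon>) w \<partial>lborel)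
        \<le> ennreal (C * (\<epsilon> powr (DIM('a) - s) + (\<epsilon> / \<delta>) ^ DIM('a)))"
proof -
  let ?N = "DIM('a)" and ?V = "unit_ball_vol DIM('a)"
  have V: "?V > 0" by simp
  obtain D where D: "D \<ge> 0" "\<And>(y::'a) A. A \<in> sets borel \<Longrightarrow>
      (\<integral>\<^sup>+w. ennreal (norm (y - w) powr - s) * indicator A w \<partial>lborel) \<le> ennreal D + emeasure lborel A"
    using nn_integral_dist_powr_le_const_plus_measure[OF s] by blast
  obtain B where B: "B \<ge> 0" "\<And>(y::'a) z \<epsilon>. \<epsilon> > 0 \<Longrightarrow>
      (\<integral>\<^sup>+w. ennreal (norm (y - w) powr - s) * indicator (cball z \<epsilon>) w \<partial>lborel) \<le> ennreal (B * \<epsilon> powr (?N - s))"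
    using nn_integral_dist_powr_cball_le[OF s] by blast
  define W where "W = D + ?V * (\<bar>R\<bar> + 1) ^ ?N"
  have W: "W \<ge> 0" using D by (simp add: W_def)
  define C where "C = 3 ^ ?N * B + 3 powr s * W"
  show thesis
  proof (rule that[of C])
    show "C \<ge> 0" using B W by (simp add: C_def)
    fix y :: 'a and F :: "'a set" and \<epsilon> \<delta> :: real
    assume F: "finite F" "F \<subseteq> cball 0 R" and e: "0 < \<epsilon>" "\<epsilon> \<le> \<delta>" "\<delta> \<le> 1"
      and sep: "\<And>z z'. z \<in> F \<Longrightarrow> z' \<in> F \<Longrightarrow> z \<noteq> z' \<Longrightarrow> 2 * \<delta> \<le> norm (z - z')"
    have d: "\<delta> > 0" using e by simp
    have [measurable]: "cball z r \<in> sets borel" "ball z r \<in> sets borel" for z :: 'a and r by simp_all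
    let ?k = "\<lambda>w. ennreal (norm (y - w) powr - s)"
    define near where "near = {z \<in> F. norm (y - z) < 2 * \<delta>}"
    define far where "far = {z \<in> F. 2 * \<delta> \<le> norm (y - z)}"
    have fin: "finite near" "finite far" using F by (auto simp: near_def far_def)
    have F_split: "F = near \<union> far" "near \<inter> far = {}" by (auto simp: near_def far_def)
    have disj: "disjoint_family_on (\<lambda>z. ball z \<delta>) F"
      using sep by (rule disjoint_family_on_balls)
    \<comment> \<open>Comparison of volumes.\<close>
    have card_near: "real (card near) \<le> 3 ^ ?N"
    proof -
      have "(\<Union>z\<in>near. ball z \<delta>) \<subseteq> ball y (3 * \<delta>)"
      proof
        fix w assume "w \<in> (\<Union>z\<in>near. ball z \<delta>)"
        then obtain z where "norm (y - z) < 2 * \<delta>" "dist z w < \<delta>" by (auto simp: near_def)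
        then show "w \<in> ball y (3 * \<delta>)"
          using dist_triangle[of y w z] by (simp add: dist_norm)
      qed
      then have "emeasure lborel (\<Union>z\<in>near. ball z \<delta>) \<le> emeasure lborel (ball y (3 * \<delta>))"
        by (intro emeasure_mono) auto
      moreover have "emeasure lborel (\<Union>z\<in>near. ball z \<delta>) = (\<Sum>z\<in>near. emeasure lborel (ball z \<delta>))"
        using disj F_split fin by (intro sum_emeasure[symmetric]) (auto intro: disjoint_family_on_mono)
      ultimately have "(\<Sum>z\<in>near. ennreal (?V * \<delta> ^ ?N)) \<le> ennreal (?V * (3 * \<delta>) ^ ?N)"
        using d by (simp add: emeasure_ball)
      then have "ennreal (real (card near) * (?V * \<delta> ^ ?N)) \<le> ennreal (3 ^ ?N * (?V * \<delta> ^ ?N))"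
        using d by (simp add: ennreal_of_nat_eq_real_of_nat ennreal_mult[symmetric] power_mult_distrib mult_ac)
      then show ?thesis using d V by (simp add: ennreal_le_iff)
    qed
    have near_le: "(\<Sum>z\<in>near. \<integral>\<^sup>+w. ?k w * indicator (cball z \<epsilon>) w \<partial>lborel) \<le> ennreal (3 ^ ?N * B * \<epsilon> powr (?N - s))"
    proof -
      have "(\<Sum>z\<in>near. \<integral>\<^sup>+w. ?k w * indicator (cball z \<epsilon>) w \<partial>lborel) \<le> (\<Sum>z\<in>near. ennreal (B * \<epsilon> powr (?N - s)))"
        by (intro sum_mono B e)
      also have "\<dots> = ennreal (real (card near) * (B * \<epsilon> powr (?N - s)))"
        using B by (simp add: ennreal_of_nat_eq_real_of_nat ennreal_mult)
      also have "\<dots> \<le> ennreal (3 ^ ?N * (B * \<epsilon> powr (?N - s)))"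
        using card_near B by (intro ennreal_leI mult_right_mono) auto
      finally show ?thesis by (simp add: mult_ac)
    qed
    let ?q = "ennreal (3 powr s * (\<epsilon> / \<delta>) ^ ?N)"
    have far1: "(\<integral>\<^sup>+w. ?k w * indicator (cball z \<epsilon>) w \<partial>lborel) \<le> ?q * (\<integral>\<^sup>+w. ?k w * indicator (ball z \<delta>) w \<partial>lborel)"
      if z: "z \<in> far" for z
    proof -
      define m where "m = norm (y - z)"
      have m: "2 * \<delta> \<le> m" "m > 0" using z d by (auto simp: far_def m_def)
      have "(\<integral>\<^sup>+w. ?k w * indicator (cball z \<epsilon>) w \<partial>lborel) \<le> (\<integral>\<^sup>+w. ennreal ((m / 2) powr - s) * indicator (cball z \<epsilon>) w \<partial>lborel)"
      proof (rule nn_integral_mono)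
        fix w
        show "?k w * indicator (cball z \<epsilon>) w \<le> ennreal ((m / 2) powr - s) * indicator (cball z \<epsilon>) w"
        proof (cases "w \<in> cball z \<epsilon>")
          case True
          then have "m / 2 \<le> norm (y - w)"
            using m e norm_triangle_ineq[of "y - w" "w - z"] by (simp add: m_def dist_norm norm_minus_commute)
          then show ?thesis using m s by (auto intro!: mult_right_mono ennreal_leI powr_mono2')
        qed auto
      qed
      also have "\<dots> = ennreal ((m / 2) powr - s * (?V * \<epsilon> ^ ?N))"
        using e by (simp add: nn_integral_cmult_indicator emeasure_cball ennreal_mult)
      also have "(m / 2) powr - s * (?V * \<epsilon> ^ ?N) = (3 powr s * (\<epsilon> / \<delta>) ^ ?N) * ((3 * m / 2) powr - s * (?V * \<delta> ^ ?N))"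
        using m d by (simp add: powr_mult powr_divide powr_minus power_divide field_simps)
      also have "ennreal \<dots> = ?q * (\<integral>\<^sup>+w. ennreal ((3 * m / 2) powr - s) * indicator (ball z \<delta>) w \<partial>lborel)"
        using d e by (simp add: nn_integral_cmult_indicator emeasure_ball ennreal_mult)
      also have "\<dots> \<le> ?q * (\<integral>\<^sup>+w. ?k w * indicator (ball z \<delta>) w \<partial>lborel)"
      proof (intro mult_left_mono nn_integral_mono)
        fix w
        show "ennreal ((3 * m / 2) powr - s) * indicator (ball z \<delta>) w \<le> ?k w * indicator (ball z \<delta>) w"
        proof (cases "w \<in> ball z \<delta>")
          case True
          then have zw: "norm (w - z) < \<delta>" "norm (z - w) < \<delta>" by (simp_all add: dist_norm norm_minus_commute)
          have "norm (y - w) \<le> m + norm (z - w)" "m \<le> norm (y - w) + norm (w - z)"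
            using norm_triangle_ineq[of "y - z" "z - w"] norm_triangle_ineq[of "y - w" "w - z"]
            by (simp_all add: m_def)
          then have *: "norm (y - w) \<le> 3 * m / 2" "norm (y - w) > 0"
            using m(1) d zw by linarith+
          then show ?thesis using m s by (auto intro!: mult_right_mono ennreal_leI powr_mono2')
        qed auto
      qed auto
      finally show ?thesis .
    qed
    have far_le: "(\<Sum>z\<in>far. \<integral>\<^sup>+w. ?k w * indicator (cball z \<epsilon>) w \<partial>lborel) \<le> ennreal (3 powr s * W * (\<epsilon> / \<delta>) ^ ?N)"
    proof -
      have "(\<Sum>z\<in>far. \<integral>\<^sup>+w. ?k w * indicator (cball z \<epsilon>) w \<partial>lborel) \<le> (\<Sum>z\<in>far. ?q * (\<integral>\<^sup>+w. ?k w * indicator (ball z \<delta>) w \<partial>lborel))"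
        by (intro sum_mono far1)
      also have "\<dots> = ?q * (\<integral>\<^sup>+w. (\<Sum>z\<in>far. ?k w * indicator (ball z \<delta>) w) \<partial>lborel)"
        by (subst nn_integral_sum) (auto simp: sum_distrib_left)
      also have "\<dots> \<le> ?q * (\<integral>\<^sup>+w. ?k w * indicator (cball 0 (\<bar>R\<bar> + 1)) w \<partial>lborel)"
      proof (intro mult_left_mono nn_integral_mono)
        fix w
        have "disjoint_family_on (\<lambda>z. ball z \<delta>) far"
          using disj F_split by (auto intro: disjoint_family_on_mono)
        then have "(\<Sum>z\<in>far. indicator (ball z \<delta>) w) = (indicator (\<Union>z\<in>far. ball z \<delta>) w :: ennreal)"
          using fin by (simp add: indicator_UN_disjoint)
        also have "\<dots> \<le> indicator (cball 0 (\<bar>R\<bar> + 1)) w"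
        proof -
          have "(\<Union>z\<in>far. ball z \<delta>) \<subseteq> cball 0 (\<bar>R\<bar> + 1)"
          proof
            fix v assume "v \<in> (\<Union>z\<in>far. ball z \<delta>)"
            then obtain z where "norm z \<le> R" "dist z v < \<delta>" using F by (auto simp: far_def)
            then show "v \<in> cball 0 (\<bar>R\<bar> + 1)"
              using e norm_triangle_ineq[of z "v - z"] by (simp add: dist_norm norm_minus_commute)
          qed
          then show ?thesis by (cases "w \<in> (\<Union>z\<in>far. ball z \<delta>)") (simp_all only: indicator_simps subset_iff zero_le order_refl simp_thms)
        qed
        finally show "(\<Sum>z\<in>far. ?k w * indicator (ball z \<delta>) w) \<le> ?k w * indicator (cball 0 (\<bar>R\<bar> + 1)) w"
          by (simp add: sum_distrib_left[symmetric] mult_left_mono)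
      qed auto
      also have "\<dots> \<le> ?q * (ennreal D + emeasure lborel (cball (0::'a) (\<bar>R\<bar> + 1)))"
        by (intro mult_left_mono D) auto
      also have "\<dots> = ennreal (3 powr s * (\<epsilon> / \<delta>) ^ ?N * W)"
      proof -
        have "ennreal D + emeasure lborel (cball (0::'a) (\<bar>R\<bar> + 1)) = ennreal W"
          using D by (simp add: emeasure_cball W_def)
        then show ?thesis using W e d by (simp add: ennreal_mult)
      qed
      finally show ?thesis by (simp add: mult_ac)
    qed
    have "(\<integral>\<^sup>+w. ?k w * indicator (\<Union>z\<in>F. cball z \<epsilon>) w \<partial>lborel) \<le> (\<integral>\<^sup>+w. (\<Sum>z\<in>F. ?k w * indicator (cball z \<epsilon>) w) \<partial>lborel)"
    proof (rule nn_integral_mono)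
      fix w
      show "?k w * indicator (\<Union>z\<in>F. cball z \<epsilon>) w \<le> (\<Sum>z\<in>F. ?k w * indicator (cball z \<epsilon>) w)"
      proof (cases "w \<in> (\<Union>z\<in>F. cball z \<epsilon>)")
        case True
        then obtain z where z: "z \<in> F" "w \<in> cball z \<epsilon>" by auto
        have "?k w * indicator (cball z \<epsilon>) w \<le> (\<Sum>z\<in>F. ?k w * indicator (cball z \<epsilon>) w)"
          by (rule member_le_sum[OF z(1)]) (use F in auto)
        then show ?thesis using True z by simp
      qed auto
    qed
    also have "\<dots> = (\<Sum>z\<in>F. \<integral>\<^sup>+w. ?k w * indicator (cball z \<epsilon>) w \<partial>lborel)"
      by (rule nn_integral_sum) auto
    also have "\<dots> = (\<Sum>z\<in>near. \<integral>\<^sup>+w. ?k w * indicator (cball z \<epsilon>) w \<partial>lborel) + (\<Sum>z\<in>far. \<integral>\<^sup>+w. ?k w * indicator (cball z \<epsilon>) w \<partial>lborel)"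
      unfolding F_split(1) using fin F_split(2) by (rule sum.union_disjoint)
    also have "\<dots> \<le> ennreal (3 ^ ?N * B * \<epsilon> powr (?N - s)) + ennreal (3 powr s * W * (\<epsilon> / \<delta>) ^ ?N)"
      by (intro add_mono near_le far_le)
    also have "\<dots> = ennreal (3 ^ ?N * B * \<epsilon> powr (?N - s) + 3 powr s * W * (\<epsilon> / \<delta>) ^ ?N)"
      using B W e d by (simp add: ennreal_plus)
    also have "\<dots> \<le> ennreal (C * (\<epsilon> powr (?N - s) + (\<epsilon> / \<delta>) ^ ?N))"
      using B W e d by (intro ennreal_leI) (simp add: C_def algebra_simps)
    finally show "(\<integral>\<^sup>+w. ?k w * indicator (\<Union>z\<in>F. cball z \<epsilon>) w \<partial>lborel)
        \<le> ennreal (C * (\<epsilon> powr (?N - s) + (\<epsilon> / \<delta>) ^ ?N))" .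
  qed
qed

section \<open>The Coulomb energy and the Coulomb--Sobolev norm\<close>

text \<open>
  Expanding the square and exchanging the order of integration turns the energy into the double integral of
  \<open>r y * r z\<close> against the composed kernel. By \<open>riesz_kernel_composition_le\<close> the integral over one of the two
  variables is at most \<open>C * T * S\<close>, and integrating over the other one contributes at most the mass
  \<open>T * emeasure lborel E\<close>.
\<close>

lemma nn_integral_square_potential_le:
  fixes a :: real
  assumes a: "DIM('a) / 2 < a" "a < DIM('a)"
  obtains C :: real where "C \<ge> 0" "\<And>(r :: 'a::euclidean_space \<Rightarrow> ennreal) E T S.
      r \<in> borel_measurable borel \<Longrightarrow> E \<in> sets borel \<Longrightarrow> (\<And>x. r x \<le> T * indicator E x) \<Longrightarrow>
      (\<And>y. (\<integral>\<^sup>+w. ennreal (norm (y - w) powr - (2 * a - DIM('a))) * indicator E w \<partial>lborel) \<le> S) \<Longrightarrow>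
      (\<integral>\<^sup>+x. (\<integral>\<^sup>+y. ennreal (norm (x - y) powr - a) * r y \<partial>lborel)\<^sup>2 \<partial>lborel)
        \<le> ennreal C * T\<^sup>2 * emeasure lborel E * S"
proof -
  let ?s = "2 * a - DIM('a)"
  obtain C where C: "C \<ge> 0" "\<And>y z :: 'a. y \<noteq> z \<Longrightarrow>
      (\<integral>\<^sup>+x. ennreal (norm (x - y) powr - a * norm (x - z) powr - a) \<partial>lborel)
        \<le> ennreal (C * norm (y - z) powr - ?s)"
    using riesz_kernel_composition_le[OF a] by blast
  show thesis
  proof (rule that[OF C(1)])
    fix r :: "'a \<Rightarrow> ennreal" and E T S
    assume [measurable]: "r \<in> borel_measurable borel" "E \<in> sets borel"
      and r: "\<And>x. r x \<le> T * indicator E x"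
      and S: "\<And>y. (\<integral>\<^sup>+w. ennreal (norm (y - w) powr - ?s) * indicator E w \<partial>lborel) \<le> S"
    let ?k = "\<lambda>x y :: 'a. ennreal (norm (x - y) powr - a)"
    define v where "v = (\<lambda>x. \<integral>\<^sup>+y. ?k x y * r y \<partial>lborel)"
    have [measurable]: "v \<in> borel_measurable borel" unfolding v_def by measurable
    have inner: "(\<integral>\<^sup>+x. ?k x y * v x \<partial>lborel) \<le> ennreal C * T * S" for y
    proof -
      have "(\<integral>\<^sup>+x. ?k x y * v x \<partial>lborel) = (\<integral>\<^sup>+x. \<integral>\<^sup>+z. ?k x y * (?k x z * r z) \<partial>lborel \<partial>lborel)"
        unfolding v_def by (intro nn_integral_cong nn_integral_cmult[symmetric]) measurable
      also have "\<dots> = (\<integral>\<^sup>+z. \<integral>\<^sup>+x. ?k x y * (?k x z * r z) \<partial>lborel \<partial>lborel)"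
        by (rule lborel_pair.Fubini'[symmetric]) measurable
      also have "\<dots> = (\<integral>\<^sup>+z. (\<integral>\<^sup>+x. ennreal (norm (x - y) powr - a * norm (x - z) powr - a) \<partial>lborel) * r z \<partial>lborel)"
        by (intro nn_integral_cong, subst nn_integral_multc[symmetric]) (auto simp: ennreal_mult mult.assoc)
      also have "\<dots> \<le> (\<integral>\<^sup>+z. ennreal C * T * (ennreal (norm (y - z) powr - ?s) * indicator E z) \<partial>lborel)"
      proof (rule nn_integral_mono_AE)
        \<comment> \<open>The bound on the composed kernel fails on the diagonal, where the power of the norm is 0.\<close>
        have "AE z in lborel. z \<noteq> y" by (rule AE_lborel_singleton)
        then show "AE z in lborel. (\<integral>\<^sup>+x. ennreal (norm (x - y) powr - a * norm (x - z) powr - a) \<partial>lborel) * r z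
            \<le> ennreal C * T * (ennreal (norm (y - z) powr - ?s) * indicator E z)"
        proof eventually_elim
          case (elim z)
          have "(\<integral>\<^sup>+x. ennreal (norm (x - y) powr - a * norm (x - z) powr - a) \<partial>lborel) * r z
            \<le> ennreal (C * norm (y - z) powr - ?s) * (T * indicator E z)"
            using elim by (intro mult_mono C r) auto
          then show ?case using C by (simp add: ennreal_mult mult_ac)
        qed
      qed
      also have "\<dots> = ennreal C * T * (\<integral>\<^sup>+z. ennreal (norm (y - z) powr - ?s) * indicator E z \<partial>lborel)"
        by (rule nn_integral_cmult) measurable
      also have "\<dots> \<le> ennreal C * T * S"
        by (intro mult_left_mono S) auto
      finally show ?thesis .
    qed
    have "(\<integral>\<^sup>+x. (v x)\<^sup>2 \<partial>lborel) = (\<integral>\<^sup>+x. \<integral>\<^sup>+y. v x * (?k x y * r y) \<partial>lborel \<partial>lborel)"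
    proof (rule nn_integral_cong)
      fix x
      have "(\<integral>\<^sup>+y. v x * (?k x y * r y) \<partial>lborel) = v x * (\<integral>\<^sup>+y. ?k x y * r y \<partial>lborel)"
        by (rule nn_integral_cmult) measurable
      then show "(v x)\<^sup>2 = (\<integral>\<^sup>+y. v x * (?k x y * r y) \<partial>lborel)"
        by (simp add: v_def power2_eq_square)
    qed
    also have "\<dots> = (\<integral>\<^sup>+y. \<integral>\<^sup>+x. v x * (?k x y * r y) \<partial>lborel \<partial>lborel)"
      by (rule lborel_pair.Fubini'[symmetric]) measurable
    also have "\<dots> = (\<integral>\<^sup>+y. (\<integral>\<^sup>+x. ?k x y * v x \<partial>lborel) * r y \<partial>lborel)"
      by (intro nn_integral_cong, subst nn_integral_multc[symmetric]) (auto simp: mult_ac)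
    also have "\<dots> \<le> (\<integral>\<^sup>+y. (ennreal C * T * S) * (T * indicator E y) \<partial>lborel)"
      by (intro nn_integral_mono mult_mono inner r) auto
    also have "\<dots> = (ennreal C * T * S) * (T * emeasure lborel E)"
      by (simp add: nn_integral_cmult nn_integral_cmult_indicator)
    also have "\<dots> = ennreal C * T\<^sup>2 * emeasure lborel E * S"
      by (simp add: power2_eq_square mult_ac)
    finally show "(\<integral>\<^sup>+x. (\<integral>\<^sup>+y. ?k x y * r y \<partial>lborel)\<^sup>2 \<partial>lborel) \<le> ennreal C * T\<^sup>2 * emeasure lborel E * S"
      unfolding v_def .
  qed
qed

lemma riesz_const_pos: "0 < \<alpha> \<Longrightarrow> \<alpha> < real N \<Longrightarrow> riesz_const N \<alpha> > 0"
  by (simp add: riesz_const_def Gamma_real_pos)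

lemma coulomb_energy_le:
  fixes \<alpha> :: real
  assumes \<alpha>: "0 < \<alpha>" "\<alpha> < DIM('a)"
  obtains C :: real where "C \<ge> 0" "\<And>p (u :: 'a::euclidean_space \<Rightarrow> real) E t S.
      0 < p \<Longrightarrow> u \<in> borel_measurable borel \<Longrightarrow> E \<in> sets borel \<Longrightarrow> (\<And>x. \<bar>u x\<bar> \<le> t * indicator E x) \<Longrightarrow>
      (\<And>y. (\<integral>\<^sup>+w. ennreal (norm (y - w) powr - (DIM('a) - \<alpha>)) * indicator E w \<partial>lborel) \<le> S) \<Longrightarrow>
      coulomb_energy \<alpha> p u \<le> ennreal C * (ennreal (t powr p))\<^sup>2 * emeasure lborel E * S"
proof -
  let ?a = "DIM('a) - \<alpha> / 2" and ?c = "riesz_const DIM('a) (\<alpha> / 2)"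
  have a: "DIM('a) / 2 < ?a" "?a < DIM('a)" and c: "?c > 0"
    using \<alpha> by (auto intro: riesz_const_pos)
  have s: "2 * ?a - DIM('a) = DIM('a) - \<alpha>" by simp
  obtain C where C: "C \<ge> 0" "\<And>(r :: 'a \<Rightarrow> ennreal) E T S.
      r \<in> borel_measurable borel \<Longrightarrow> E \<in> sets borel \<Longrightarrow> (\<And>x. r x \<le> T * indicator E x) \<Longrightarrow>
      (\<And>y. (\<integral>\<^sup>+w. ennreal (norm (y - w) powr - (DIM('a) - \<alpha>)) * indicator E w \<partial>lborel) \<le> S) \<Longrightarrow>
      (\<integral>\<^sup>+x. (\<integral>\<^sup>+y. ennreal (norm (x - y) powr - ?a) * r y \<partial>lborel)\<^sup>2 \<partial>lborel)
        \<le> ennreal C * T\<^sup>2 * emeasure lborel E * S"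
    using nn_integral_square_potential_le[OF a] unfolding s by blast
  show thesis
  proof (rule that[of "?c\<^sup>2 * C"])
    show "?c\<^sup>2 * C \<ge> 0" using C by simp
    fix p t :: real and S and u :: "'a \<Rightarrow> real" and E
    assume p: "0 < p" and [measurable]: "u \<in> borel_measurable borel" "E \<in> sets borel"
      and u: "\<And>x. \<bar>u x\<bar> \<le> t * indicator E x"
      and S: "\<And>y. (\<integral>\<^sup>+w. ennreal (norm (y - w) powr - (DIM('a) - \<alpha>)) * indicator E w \<partial>lborel) \<le> S"
    let ?r = "\<lambda>y. ennreal (\<bar>u y\<bar> powr p)"
    have r: "?r x \<le> ennreal (t powr p) * indicator E x" for x
      using u[of x] p by (auto simp: indicator_def intro!: ennreal_leI powr_mono2 split: if_splits)
    let ?v = "\<lambda>x. \<integral>\<^sup>+y. ennreal (norm (x - y) powr - ?a) * ?r y \<partial>lborel"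
    have pot: "riesz_potential (\<alpha> / 2) (\<lambda>y. \<bar>u y\<bar> powr p) x = ennreal ?c * ?v x" for x
    proof -
      have "riesz_potential (\<alpha> / 2) (\<lambda>y. \<bar>u y\<bar> powr p) x
          = (\<integral>\<^sup>+y. ennreal (riesz_kernel (\<alpha> / 2) (x - y) * \<bar>u y\<bar> powr p) \<partial>lborel)"
        by (simp add: riesz_potential_def nn_integral_completion)
      also have "\<dots> = (\<integral>\<^sup>+y. ennreal ?c * (ennreal (norm (x - y) powr - ?a) * ?r y) \<partial>lborel)"
        using c by (intro nn_integral_cong) (simp add: riesz_kernel_def ennreal_mult mult.assoc)
      also have "\<dots> = ennreal ?c * ?v x"
        by (rule nn_integral_cmult) measurable
      finally show ?thesis .
    qed
    have "coulomb_energy \<alpha> p u = (\<integral>\<^sup>+x. (ennreal ?c)\<^sup>2 * (?v x)\<^sup>2 \<partial>lborel)"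
      by (simp add: coulomb_energy_def pot nn_integral_completion power_mult_distrib)
    also have "\<dots> = (ennreal ?c)\<^sup>2 * (\<integral>\<^sup>+x. (?v x)\<^sup>2 \<partial>lborel)"
      by (rule nn_integral_cmult) measurable
    also have "\<dots> \<le> (ennreal ?c)\<^sup>2 * (ennreal C * (ennreal (t powr p))\<^sup>2 * emeasure lborel E * S)"
      by (intro mult_left_mono C r S) auto
    also have "(ennreal ?c)\<^sup>2 = ennreal (?c\<^sup>2)" using c by (simp add: ennreal_power)
    finally show "coulomb_energy \<alpha> p u \<le> ennreal (?c\<^sup>2 * C) * (ennreal (t powr p))\<^sup>2 * emeasure lborel E * S"
      using C by (simp add: ennreal_mult mult.assoc)
  qed
qed

text \<open>
  The norm refers to the weak gradient, which may be replaced by the classical one because they agree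
  almost everywhere; the weak gradient is then measurable because the measure is complete.
\<close>

lemma coulomb_sobolev_norm_le:
  fixes u :: "'a::euclidean_space \<Rightarrow> real"
  assumes u: "u \<in> C_c_inf" and E: "E \<in> sets borel" "emeasure lborel E \<le> ennreal e" "e \<ge> 0"
    and G: "\<And>x. norm (gradient u x) \<le> G * indicator E x"
    and K: "coulomb_energy \<alpha> p u \<le> ennreal K" "K \<ge> 0" and p: "p > 0"
  shows "u \<in> coulomb_sobolev \<alpha> p" "coulomb_sobolev_norm \<alpha> p u \<le> sqrt (G\<^sup>2 * e + K powr (1 / p))"
proof -
  have s: "smooth u" using u by (simp add: C_c_inf_def)
  have fE: "emeasure lborel E < \<infinity>" using E(2) by (rule le_less_trans) simp
  have mg [measurable]: "gradient u \<in> borel_measurable borel"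
    by (rule borel_measurable_continuous_onI[OF continuous_gradient[OF s]])
  have iE: "integrable lborel (\<lambda>x. G\<^sup>2 * indicator E x)"
    using E(1) fE by (intro integrable_mult_right integrable_real_indicator) auto
  have le: "(norm (gradient u x))\<^sup>2 \<le> G\<^sup>2 * indicator E x" for x
    using power_mono[OF G[of x], of 2] by (auto simp: indicator_def split: if_splits)
  have ig: "integrable lborel (\<lambda>x. (norm (gradient u x))\<^sup>2)"
    by (rule Bochner_Integration.integrable_bound[OF iE]) (use le in \<open>auto simp: abs_of_nonneg\<close>)
  have igc: "integrable lebesgue (\<lambda>x. (norm (gradient u x))\<^sup>2)"
    using ig by (simp add: integrable_completion)
  have ae: "AE x in lebesgue. (norm (gradient u x))\<^sup>2 = (norm (weak_gradient u x))\<^sup>2"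
    using weak_gradient_AE_eq_gradient[OF s] by eventually_elim simp
  have mw: "(\<lambda>x. (norm (weak_gradient u x))\<^sup>2) \<in> borel_measurable lebesgue"
  proof (rule borel_measurableI)
    fix A :: "real set" assume "open A"
    have "(\<lambda>x. (norm (gradient u x))\<^sup>2) \<in> borel_measurable lebesgue"
      using igc by (rule borel_measurable_integrable)
    then have A: "(\<lambda>x. (norm (gradient u x))\<^sup>2) -` A \<inter> space lebesgue \<in> sets lebesgue"
      using \<open>open A\<close> by (intro measurable_sets[of _ lebesgue borel]) auto
    have AE: "AE x in lebesgue. x \<in> (\<lambda>x. (norm (gradient u x))\<^sup>2) -` A \<inter> space lebesgue \<longleftrightarrow>
        x \<in> (\<lambda>x. (norm (weak_gradient u x))\<^sup>2) -` A \<inter> space lebesgue"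
      using ae by eventually_elim simp
    show "(\<lambda>x. (norm (weak_gradient u x))\<^sup>2) -` A \<inter> space lebesgue \<in> sets lebesgue"
      by (rule completion.in_sets_AE[OF AE A]) simp
  qed
  have iw: "integrable lebesgue (\<lambda>x. (norm (weak_gradient u x))\<^sup>2)"
    using igc integrable_cong_AE[OF borel_measurable_integrable[OF igc] mw ae] by simp
  have mu: "u \<in> borel_measurable lebesgue"
    using borel_measurable_continuous_onI[OF smooth_continuous[OF s]] by (simp add: measurable_completion)
  show "u \<in> coulomb_sobolev \<alpha> p"
    using mu iw K(1) gradient_is_weak_gradient[OF s]
    by (auto simp: coulomb_sobolev_def weakly_differentiable_def intro: le_less_trans)
  have "(LINT x|lebesgue. (norm (weak_gradient u x))\<^sup>2) = (LINT x|lebesgue. (norm (gradient u x))\<^sup>2)"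
    using ae by (intro integral_cong_AE mw borel_measurable_integrable[OF igc]) auto
  also have "\<dots> = (LINT x|lborel. (norm (gradient u x))\<^sup>2)"
    by (rule integral_completion) measurable
  also have "\<dots> \<le> (LINT x|lborel. G\<^sup>2 * indicator E x)"
    by (intro integral_mono ig iE le)
  also have "\<dots> = G\<^sup>2 * measure lborel E" using E by simp
  also have "\<dots> \<le> G\<^sup>2 * e"
    using E(2,3) by (intro mult_left_mono) (auto simp: measure_def enn2real_leI)
  finally have 1: "(LINT x|lebesgue. (norm (weak_gradient u x))\<^sup>2) \<le> G\<^sup>2 * e" .
  have "enn2real (coulomb_energy \<alpha> p u) \<le> K" using K by (intro enn2real_leI)
  then have "enn2real (coulomb_energy \<alpha> p u) powr (1 / p) \<le> K powr (1 / p)"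
    using p by (intro powr_mono2) auto
  with 1 show "coulomb_sobolev_norm \<alpha> p u \<le> sqrt (G\<^sup>2 * e + K powr (1 / p))"
    unfolding coulomb_sobolev_norm_def by (intro real_sqrt_le_mono add_mono)
qed

section \<open>Clusters of bumps on a grid\<close>

text \<open>
  The points of the unit cube with coordinates in \<open>{0, 1 / k, \<dots>, (k - 1) / k}\<close>. The radius
  \<open>N\<close> of the ball is crude; only its independence of \<open>k\<close> matters.
\<close>

lemma exists_grid:
  assumes k: "k > (0::nat)"
  obtains F :: "'a::euclidean_space set" where
    "finite F" "card F = k ^ DIM('a)" "F \<subseteq> cball 0 DIM('a)"
    "\<And>z z'. z \<in> F \<Longrightarrow> z' \<in> F \<Longrightarrow> z \<noteq> z' \<Longrightarrow> 1 / real k \<le> norm (z - z')"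
proof -
  define P :: "('a \<Rightarrow> nat) \<Rightarrow> 'a" where "P = (\<lambda>f. \<Sum>b\<in>Basis. (real (f b) / real k) *\<^sub>R b)"
  define I where "I = PiE (Basis :: 'a set) (\<lambda>_. {..<k})"
  have P_inner: "P f \<bullet> b = real (f b) / real k" if "b \<in> Basis" for f b
    using that by (simp add: P_def inner_sum_left_Basis)
  have sep: "1 / real k \<le> norm (P f - P g)" if b: "b \<in> Basis" "f b \<noteq> g b" for f g b
  proof -
    have "1 \<le> \<bar>real (f b) - real (g b)\<bar>" using b by linarith
    then have "1 / real k \<le> \<bar>(P f - P g) \<bullet> b\<bar>"
      using k b by (simp add: inner_diff_left P_inner diff_divide_distrib[symmetric] divide_right_mono)
    also have "\<dots> \<le> norm (P f - P g)" using b by (intro Basis_le_norm)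
    finally show ?thesis .
  qed
  have inj: "inj_on P I"
  proof (rule inj_onI)
    fix f g assume fg: "f \<in> I" "g \<in> I" "P f = P g"
    have "f b = g b" if "b \<in> Basis" for b
      using sep[OF that, of f g] fg k by auto
    with fg show "f = g" unfolding I_def by (auto intro: PiE_ext)
  qed
  show thesis
  proof (rule that[of "P ` I"])
    show "finite (P ` I)" unfolding I_def by (intro finite_imageI finite_PiE) auto
    have "card (P ` I) = card I" using inj by (rule card_image)
    also have "\<dots> = k ^ DIM('a)" by (simp add: I_def card_PiE)
    finally show "card (P ` I) = k ^ DIM('a)" .
    show "P ` I \<subseteq> cball 0 DIM('a)"
    proof
      fix z assume "z \<in> P ` I"
      then obtain f where f: "f \<in> I" "z = P f" by auto
      have "norm z \<le> (\<Sum>b\<in>Basis. \<bar>z \<bullet> b\<bar>)" by (rule norm_le_l1)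
      also have "\<dots> \<le> (\<Sum>b\<in>(Basis::'a set). 1)"
      proof (rule sum_mono)
        fix b :: 'a assume b: "b \<in> Basis"
        then have "f b < k" using f by (auto simp: I_def)
        then show "\<bar>z \<bullet> b\<bar> \<le> 1" using b k by (simp add: f P_inner)
      qed
      finally show "z \<in> cball 0 DIM('a)" by simp
    qed
    fix z z' assume "z \<in> P ` I" "z' \<in> P ` I" "z \<noteq> z'"
    then obtain f g where fg: "z = P f" "z' = P g" "P f \<noteq> P g" by auto
    then have "\<exists>b\<in>Basis. f b \<noteq> g b" unfolding P_def by (metis (no_types, lifting) sum.cong)
    then show "1 / real k \<le> norm (z - z')" using sep fg by blast
  qed
qed

lemma smooth_norm_diff_squared: "smooth (\<lambda>x::'a::euclidean_space. (norm (x - z))\<^sup>2)"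
proof -
  have eq: "(\<lambda>x. (norm (x - z))\<^sup>2) = (\<lambda>x. \<Sum>b\<in>Basis. (x \<bullet> b - z \<bullet> b) * (x \<bullet> b - z \<bullet> b))"
  proof
    fix x
    show "(norm (x - z))\<^sup>2 = (\<Sum>b\<in>Basis. (x \<bullet> b - z \<bullet> b) * (x \<bullet> b - z \<bullet> b))"
      using euclidean_inner[of "x - z" "x - z"] by (simp only: power2_norm_eq_inner inner_diff_left)
  qed
  show ?thesis
    unfolding eq by (intro smooth_sum smooth_mult smooth_diff smooth_const smooth_bounded_linear bounded_linear_inner_left)
qed

lemma gradient_eqI: "(u has_derivative (\<lambda>h. G \<bullet> h)) (at x) \<Longrightarrow> gradient u x = G"
  by (simp add: gradient_def frechet_derivative_eqI euclidean_representation)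

lemma flat_2_le: "flat 2 s \<le> 2"
proof (cases "s > 0")
  case True
  have "(1 / s)\<^sup>2 / 2 \<le> exp (1 / s)"
    using exp_lower_Taylor_quadratic[of "1 / s"] divide_pos_pos[of 1 s] True by linarith
  then show ?thesis using True by (simp add: flat_def exp_minus field_simps)
qed simp

text \<open>
  The value \<open>3 / 4\<close> is that of \<open>1 - (norm (x - z))\<^sup>2 / \<epsilon>\<^sup>2\<close> at distance \<open>\<epsilon> / 2\<close> from the
  centre of a bump.
\<close>

lemma flat_0_ge:
  assumes "3 / 4 \<le> s" shows "exp (- 4 / 3) \<le> flat 0 s"
  using frac_le[of 1 1 "3/4" s] assms by (simp add: flat_def)

text \<open>
  Each summand is a bump of height at most \<open>t\<close> supported in the closed ball of radius
  \<open>\<epsilon>\<close> around \<open>z\<close>. Subtracting the square of the norm, and not the norm, keeps the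
  argument of \<open>flat 0\<close> smooth at the centre.
\<close>

definition cluster :: "real \<Rightarrow> real \<Rightarrow> 'a::euclidean_space set \<Rightarrow> 'a \<Rightarrow> real" where
  "cluster t \<epsilon> F x = (\<Sum>z\<in>F. t * flat 0 (1 - (norm (x - z))\<^sup>2 / \<epsilon>\<^sup>2))"

lemma smooth_cluster: "smooth (cluster t \<epsilon> F)"
proof -
  have "smooth (\<lambda>x::'a. 1 - (norm (x - z))\<^sup>2 * (1 / \<epsilon>\<^sup>2))" for z
    by (intro smooth_diff smooth_mult smooth_const smooth_norm_diff_squared)
  then have "smooth (\<lambda>x::'a. \<Sum>z\<in>F. t * flat 0 (1 - (norm (x - z))\<^sup>2 / \<epsilon>\<^sup>2))"
    by (intro smooth_sum smooth_mult smooth_const smooth_flat) simp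
  then show ?thesis by (simp add: cluster_def[abs_def])
qed

lemma gradient_cluster:
  "gradient (cluster t \<epsilon> F) x
    = (\<Sum>z\<in>F. (- 2 * t * flat 2 (1 - (norm (x - z))\<^sup>2 / \<epsilon>\<^sup>2) / \<epsilon>\<^sup>2) *\<^sub>R (x - z))"
proof (rule gradient_eqI)
  have "((\<lambda>x. t * flat 0 (1 - (norm (x - z))\<^sup>2 / \<epsilon>\<^sup>2)) has_derivative
      (\<lambda>h. ((- 2 * t * flat 2 (1 - (norm (x - z))\<^sup>2 / \<epsilon>\<^sup>2) / \<epsilon>\<^sup>2) *\<^sub>R (x - z)) \<bullet> h)) (at x)" for z
  proof -
    have "((\<lambda>x. 1 - ((x - z) \<bullet> (x - z)) * c) has_derivative (\<lambda>h. - (2 * ((x - z) \<bullet> h) * c))) (at x)" for c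
      by (auto intro!: derivative_eq_intros simp: inner_commute)
    from this[of "1 / \<epsilon>\<^sup>2"] have "((\<lambda>x. 1 - (norm (x - z))\<^sup>2 / \<epsilon>\<^sup>2) has_derivative (\<lambda>h. - (2 * ((x - z) \<bullet> h) / \<epsilon>\<^sup>2))) (at x)"
      by (simp add: power2_norm_eq_inner)
    from has_derivative_compose[OF this flat_has_derivative[where j = 0, unfolded has_field_derivative_def]]
    have "((\<lambda>x. flat 0 (1 - (norm (x - z))\<^sup>2 / \<epsilon>\<^sup>2)) has_derivative
       (\<lambda>h. flat 2 (1 - (norm (x - z))\<^sup>2 / \<epsilon>\<^sup>2) * - (2 * ((x - z) \<bullet> h) / \<epsilon>\<^sup>2))) (at x)"
      by (simp add: numeral_2_eq_2)
    from has_derivative_mult_right[OF this, of t] show ?thesis by (simp add: mult_ac)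
  qed
  then show "(cluster t \<epsilon> F has_derivative
     (\<lambda>h. (\<Sum>z\<in>F. (- 2 * t * flat 2 (1 - (norm (x - z))\<^sup>2 / \<epsilon>\<^sup>2) / \<epsilon>\<^sup>2) *\<^sub>R (x - z)) \<bullet> h)) (at x)"
    unfolding cluster_def[abs_def] inner_sum_left by (intro has_derivative_sum)
qed

text \<open>
  Applied to the summands of a cluster and of its gradient: the bumps are disjoint, hence the bound does
  not see their number.
\<close>

lemma norm_sum_le_if_one_nonzero:
  fixes f :: "'b \<Rightarrow> 'a::real_normed_vector"
  assumes "finite F" "B \<ge> 0" "\<And>z. z \<in> F \<Longrightarrow> norm (f z) \<le> B"
    and one: "\<And>z z'. z \<in> F \<Longrightarrow> z' \<in> F \<Longrightarrow> f z \<noteq> 0 \<Longrightarrow> f z' \<noteq> 0 \<Longrightarrow> z = z'"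
  shows "norm (\<Sum>z\<in>F. f z) \<le> B"
proof (cases "\<exists>z\<in>F. f z \<noteq> 0")
  case True
  then obtain z where z: "z \<in> F" "f z \<noteq> 0" by auto
  have "(\<Sum>z\<in>F. f z) = (\<Sum>z\<in>{z}. f z)"
    using z one assms(1) by (intro sum.mono_neutral_right) auto
  then show ?thesis using assms(3)[OF z(1)] by simp
qed (use assms(2) in simp)

lemma flat_profile_nonzero_imp:
  assumes "flat j (1 - (norm (x - z))\<^sup>2 / \<epsilon>\<^sup>2) \<noteq> 0" "\<epsilon> > 0"
  shows "norm (x - z) < \<epsilon>"
proof (rule ccontr)
  assume "\<not> norm (x - z) < \<epsilon>"
  then have "\<epsilon>\<^sup>2 \<le> (norm (x - z))\<^sup>2" using assms(2) by (intro power_mono) auto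
  then have "1 - (norm (x - z))\<^sup>2 / \<epsilon>\<^sup>2 \<le> 0" using assms(2) by simp
  then show False using assms(1) by simp
qed

context
  fixes F :: "'a::euclidean_space set" and t \<epsilon> :: real
  assumes F: "finite F" and t: "t \<ge> 0" and \<epsilon>: "\<epsilon> > 0"
    and sep: "\<And>z z'. z \<in> F \<Longrightarrow> z' \<in> F \<Longrightarrow> z \<noteq> z' \<Longrightarrow> 2 * \<epsilon> \<le> norm (z - z')"
begin

lemma cluster_one_active:
  assumes "z \<in> F" "z' \<in> F" "norm (x - z) < \<epsilon>" "norm (x - z') < \<epsilon>"
  shows "z = z'"
  using sep[OF assms(1,2)] norm_triangle_ineq4[of "x - z'" "x - z"] assms(3,4) by fastforce

lemma cluster_summand_zero:
  assumes "x \<notin> (\<Union>z\<in>F. cball z \<epsilon>)" "z \<in> F"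
  shows "flat j (1 - (norm (x - z))\<^sup>2 / \<epsilon>\<^sup>2) = 0"
  using flat_profile_nonzero_imp[of j x z \<epsilon>] \<epsilon> assms by (force simp: dist_norm norm_minus_commute)

lemma abs_cluster_le: "\<bar>cluster t \<epsilon> F x\<bar> \<le> t * indicator (\<Union>z\<in>F. cball z \<epsilon>) x"
proof (cases "x \<in> (\<Union>z\<in>F. cball z \<epsilon>)")
  case True
  have "norm (cluster t \<epsilon> F x) \<le> t"
    unfolding cluster_def
  proof (rule norm_sum_le_if_one_nonzero[OF F t])
    show "norm (t * flat 0 (1 - (norm (x - z))\<^sup>2 / \<epsilon>\<^sup>2)) \<le> t" for z
      using t flat_0_le_1[of "1 - (norm (x - z))\<^sup>2 / \<epsilon>\<^sup>2"] by (simp add: abs_mult mult_left_le)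
  qed (use \<epsilon> cluster_one_active flat_profile_nonzero_imp in fastforce)
  then show ?thesis using True by simp
next
  case False
  then have "cluster t \<epsilon> F x = 0"
    unfolding cluster_def by (intro sum.neutral) (simp add: cluster_summand_zero)
  then show ?thesis using t by simp
qed

lemma norm_gradient_cluster_le:
  "norm (gradient (cluster t \<epsilon> F) x) \<le> 4 * t / \<epsilon> * indicator (\<Union>z\<in>F. cball z \<epsilon>) x"
proof (cases "x \<in> (\<Union>z\<in>F. cball z \<epsilon>)")
  case True
  have "norm (gradient (cluster t \<epsilon> F) x) \<le> 4 * t / \<epsilon>"
    unfolding gradient_cluster
  proof (rule norm_sum_le_if_one_nonzero[OF F])
    let ?f = "\<lambda>z. flat 2 (1 - (norm (x - z))\<^sup>2 / \<epsilon>\<^sup>2)"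
    show "0 \<le> 4 * t / \<epsilon>" using t \<epsilon> by simp
    fix z
    show "norm ((- 2 * t * ?f z / \<epsilon>\<^sup>2) *\<^sub>R (x - z)) \<le> 4 * t / \<epsilon>"
    proof (cases "?f z = 0")
      case False
      then have "norm (x - z) < \<epsilon>" using flat_profile_nonzero_imp \<epsilon> by blast
      then have "2 * t * ?f z / \<epsilon>\<^sup>2 * norm (x - z) \<le> 2 * t * 2 / \<epsilon>\<^sup>2 * \<epsilon>"
        using t \<epsilon> by (intro mult_mono divide_right_mono mult_left_mono flat_2_le) auto
      also have "\<dots> = 4 * t / \<epsilon>" using \<epsilon> by (simp add: power2_eq_square)
      finally show ?thesis using t by (simp add: abs_mult)
    qed (use t \<epsilon> in simp)
  qed (use \<epsilon> cluster_one_active flat_profile_nonzero_imp in fastforce)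
  then show ?thesis using True by simp
next
  case False
  then have "gradient (cluster t \<epsilon> F) x = 0"
    unfolding gradient_cluster by (intro sum.neutral) (simp add: cluster_summand_zero)
  then show ?thesis using t \<epsilon> by simp
qed

lemma cluster_ge:
  assumes z: "z \<in> F" "norm (x - z) \<le> \<epsilon> / 2"
  shows "t * exp (- 4 / 3) \<le> cluster t \<epsilon> F x"
proof -
  let ?s = "1 - (norm (x - z))\<^sup>2 / \<epsilon>\<^sup>2"
  have "(norm (x - z))\<^sup>2 \<le> (\<epsilon> / 2)\<^sup>2" using z by (intro power_mono) auto
  then have s: "3 / 4 \<le> ?s" using \<epsilon> by (simp add: power_divide field_simps)
  then have "exp (- 4 / 3) \<le> flat 0 ?s" by (rule flat_0_ge)
  then have "t * exp (- 4 / 3) \<le> t * flat 0 ?s" using t by (rule mult_left_mono)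
  also have "\<dots> \<le> cluster t \<epsilon> F x"
    unfolding cluster_def by (rule member_le_sum[OF z(1)]) (use t F in auto)
  finally show ?thesis .
qed

lemma emeasure_cluster_balls_le:
  "emeasure lborel (\<Union>z\<in>F. cball z \<epsilon>) \<le> ennreal (real (card F) * (unit_ball_vol DIM('a) * \<epsilon> ^ DIM('a)))"
proof -
  have "emeasure lborel (\<Union>z\<in>F. cball z \<epsilon>) \<le> (\<Sum>z\<in>F. emeasure lborel (cball z \<epsilon>))"
    using F by (intro emeasure_subadditive_finite) auto
  also have "\<dots> = ennreal (real (card F) * (unit_ball_vol DIM('a) * \<epsilon> ^ DIM('a)))"
    using \<epsilon> by (simp add: emeasure_cball ennreal_of_nat_eq_real_of_nat ennreal_mult)
  finally show ?thesis .
qed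

text \<open>
  Only the balls of half the radius are used, where each bump is bounded below by
  \<open>t * exp (- 4 / 3)\<close>.
\<close>

lemma nn_integral_cluster_powr_ge:
  assumes q: "q > 0"
  shows "ennreal (real (card F) * ((t * exp (- 4 / 3)) powr q * (unit_ball_vol DIM('a) * (\<epsilon> / 2) ^ DIM('a))))
    \<le> (\<integral>\<^sup>+x. ennreal (\<bar>cluster t \<epsilon> F x\<bar> powr q) \<partial>lebesgue)"
proof -
  let ?U = "\<Union>z\<in>F. ball z (\<epsilon> / 2)" and ?c = "(t * exp (- 4 / 3)) powr q"
  have "disjoint_family_on (\<lambda>z. ball z (\<epsilon> / 2)) F"
    using sep \<epsilon> by (intro disjoint_family_on_balls) fastforce
  then have "emeasure lborel ?U = (\<Sum>z\<in>F. emeasure lborel (ball z (\<epsilon> / 2)))"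
    using F by (intro sum_emeasure[symmetric]) auto
  also have "\<dots> = ennreal (real (card F) * (unit_ball_vol DIM('a) * (\<epsilon> / 2) ^ DIM('a)))"
    using \<epsilon> by (simp add: emeasure_ball ennreal_of_nat_eq_real_of_nat ennreal_mult)
  finally have U: "emeasure lborel ?U = ennreal (real (card F) * (unit_ball_vol DIM('a) * (\<epsilon> / 2) ^ DIM('a)))" .
  have "ennreal (real (card F) * (?c * (unit_ball_vol DIM('a) * (\<epsilon> / 2) ^ DIM('a)))) = ennreal ?c * emeasure lborel ?U"
    unfolding U using \<epsilon> by (subst ennreal_mult[symmetric]) (auto simp: mult_ac)
  also have "\<dots> = (\<integral>\<^sup>+x. ennreal ?c * indicator ?U x \<partial>lborel)"
    by (rule nn_integral_cmult_indicator[symmetric]) (use F in auto)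
  also have "\<dots> = (\<integral>\<^sup>+x. ennreal ?c * indicator ?U x \<partial>lebesgue)"
    by (simp add: nn_integral_completion)
  also have "\<dots> \<le> (\<integral>\<^sup>+x. ennreal (\<bar>cluster t \<epsilon> F x\<bar> powr q) \<partial>lebesgue)"
  proof (rule nn_integral_mono)
    fix x
    show "ennreal ?c * indicator ?U x \<le> ennreal (\<bar>cluster t \<epsilon> F x\<bar> powr q)"
    proof (cases "x \<in> ?U")
      case True
      then obtain z where "z \<in> F" "norm (x - z) \<le> \<epsilon> / 2" by (auto simp: dist_norm norm_minus_commute)
      from cluster_ge[OF this] have "?c \<le> \<bar>cluster t \<epsilon> F x\<bar> powr q"
        using t q by (intro powr_mono2) auto
      then show ?thesis using True by (simp add: ennreal_leI)
    qed simp
  qed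
  finally show ?thesis .
qed

lemma cluster_in_C_c_inf: "cluster t \<epsilon> F \<in> C_c_inf"
  and supp_cluster_subset: "supp (cluster t \<epsilon> F) \<subseteq> (\<Union>z\<in>F. cball z \<epsilon>)"
proof -
  have c: "compact (\<Union>z\<in>F. cball z \<epsilon>)" using F by (intro compact_UN) auto
  have 0: "cluster t \<epsilon> F x = 0" if "x \<notin> (\<Union>z\<in>F. cball z \<epsilon>)" for x
    using abs_cluster_le[of x] that by simp
  show "cluster t \<epsilon> F \<in> C_c_inf" by (rule C_c_infI[OF smooth_cluster c 0])
  show "supp (cluster t \<epsilon> F) \<subseteq> (\<Union>z\<in>F. cball z \<epsilon>)" by (rule supp_subset[OF compact_imp_closed[OF c] 0])
qed

end

section \<open>Concentrating sequences\<close>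

text \<open>
  Here \<open>M = 2 powr - m * \<epsilon> powr - m\<close> bumps of height \<open>t = \<epsilon> powr - \<tau>\<close> are used; the factor
  \<open>2 powr - m\<close> is an effect of the factor \<open>1 / 2\<close> in \<open>\<epsilon>\<close>, which makes the balls of radius \<open>\<epsilon>\<close>
  disjoint. The three conditions on \<open>m\<close> and \<open>\<tau>\<close> say that the Dirichlet integral and the self-energy
  of the bumps stay bounded and that the \<open>q\<close>-integral has a constant order of magnitude.
  The interaction energy has exponent \<open>2 N - 2 m - 2 p \<tau>\<close>, which is nonnegative by the condition on the
  self-energy together with \<open>m \<le> N - \<alpha>\<close>.
\<close>

lemma concentrating_sequence_exists:
  fixes \<alpha> p m \<tau> q :: real
  assumes \<alpha>: "0 < \<alpha>" "\<alpha> < DIM('a)" and p: "0 < p" and q: "0 < q"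
    and m: "0 < m" "m \<le> DIM('a) - \<alpha>"
    and grad: "m + 2 * \<tau> + 2 \<le> DIM('a)"
    and self: "m + 2 * p * \<tau> \<le> DIM('a) + \<alpha>"
    and norm_q: "m + q * \<tau> = DIM('a)"
  shows "\<exists>u :: nat \<Rightarrow> 'a::euclidean_space \<Rightarrow> real.
    (\<forall>n. u n \<in> C_c_inf) \<and>
    bounded (\<Union>n. supp (u n)) \<and>
    bounded_in_coulomb_sobolev \<alpha> p u \<and>
    (AE x in lebesgue. (\<lambda>n. u n x) \<longlonglongrightarrow> 0) \<and>
    0 < liminf (\<lambda>n. \<integral>\<^sup>+ x. ennreal (\<bar>u n x\<bar> powr q) \<partial>lebesgue)"
proof -
  let ?N = "DIM('a)" and ?V = "unit_ball_vol DIM('a)"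
  have V: "?V > 0" by simp
  have m_less: "m < ?N" using m \<alpha> by simp
  \<comment> \<open>\<open>\<epsilon>\<close> is chosen such that the number of grid points \<open>k ^ N\<close> is proportional to \<open>\<epsilon> powr - m\<close>.
    Powers of 2 are taken for \<open>k\<close> because the measures of the supports have to be summable.\<close>
  define k :: "nat \<Rightarrow> nat" where "k n = 2 ^ n" for n
  define \<epsilon> :: "nat \<Rightarrow> real" where "\<epsilon> n = 1 / 2 * real (k n) powr - (?N / m)" for n
  define t :: "nat \<Rightarrow> real" where "t n = \<epsilon> n powr - \<tau>" for n
  have k: "k n > 0" "real (k n) \<ge> 1" for n by (simp_all add: k_def)
  have \<epsilon>0: "\<epsilon> n > 0" for n using k[of n] by (simp add: \<epsilon>_def)
  have \<epsilon>_le: "\<epsilon> n \<le> 1 / (2 * real (k n))" for n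
  proof -
    have "real (k n) powr - (?N / m) \<le> real (k n) powr - 1"
      using k[of n] m m_less by (intro powr_mono) (auto simp: field_simps)
    also have "\<dots> = 1 / real (k n)" using k[of n] by (simp add: powr_minus_divide)
    finally show ?thesis by (simp add: \<epsilon>_def field_simps)
  qed
  have \<epsilon>1: "\<epsilon> n \<le> 1" for n
  proof -
    have "1 / (2 * real (k n)) \<le> 1" using k[of n] by (simp add: field_simps)
    then show ?thesis using \<epsilon>_le[of n] by linarith
  qed
  have \<epsilon>_powr_le: "\<epsilon> n powr x \<le> 1" if "x \<ge> 0" for n x
    using \<epsilon>0[of n] \<epsilon>1[of n] that by (intro powr_le1) auto
  have t0: "t n \<ge> 0" for n by (simp add: t_def)
  define Q where "Q = 2 powr - m"
  have Q: "Q > 0" by (simp add: Q_def)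
  have \<epsilon>N: "\<epsilon> n ^ ?N = \<epsilon> n powr ?N" for n using \<epsilon>0[of n] by (simp add: powr_realpow)
  \<comment> \<open>From here on every quantity is a constant times a power of \<open>\<epsilon> n\<close>.\<close>
  have M: "real (k n ^ ?N) = Q * \<epsilon> n powr - m" for n
  proof -
    have "\<epsilon> n powr - m = (1 / 2) powr - m * real (k n) powr (?N / m * m)"
      unfolding \<epsilon>_def by (subst powr_mult) (auto simp: powr_powr)
    also have "\<dots> = 2 powr m * real (k n) ^ ?N"
      using m k[of n] by (simp add: powr_realpow powr_divide powr_minus)
    finally show ?thesis by (simp add: Q_def powr_minus field_simps)
  qed
  have "\<exists>F :: 'a set. finite F \<and> card F = k n ^ ?N \<and> F \<subseteq> cball 0 ?N \<and>
      (\<forall>z\<in>F. \<forall>z'\<in>F. z \<noteq> z' \<longrightarrow> 1 / real (k n) \<le> norm (z - z'))" for n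
    using exists_grid[OF k(1)[of n]] by metis
  then obtain F :: "nat \<Rightarrow> 'a set" where F: "\<And>n. finite (F n)" "\<And>n. card (F n) = k n ^ ?N"
      "\<And>n. F n \<subseteq> cball 0 ?N"
      and sep: "\<And>n z z'. z \<in> F n \<Longrightarrow> z' \<in> F n \<Longrightarrow> z \<noteq> z' \<Longrightarrow> 1 / real (k n) \<le> norm (z - z')"
    by metis
  have sep\<epsilon>: "2 * \<epsilon> n \<le> norm (z - z')" if "z \<in> F n" "z' \<in> F n" "z \<noteq> z'" for n z z'
    using sep[OF that] \<epsilon>_le[of n] by (simp add: field_simps)
  define E where "E n = (\<Union>z\<in>F n. cball z (\<epsilon> n))" for n
  define u where "u n = cluster (t n) (\<epsilon> n) (F n)" for n
  note cl = F(1) t0 \<epsilon>0 sep\<epsilon>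
  have abs_u: "\<bar>u n x\<bar> \<le> t n * indicator (E n) x" for n x
    unfolding u_def E_def by (rule abs_cluster_le[OF cl])
  have E_borel: "E n \<in> sets borel" for n
    unfolding E_def using F(1) by (intro borel_closed closed_UN) auto
  define e where "e n = ?V * Q * \<epsilon> n powr (?N - m)" for n
  have e0: "e n \<ge> 0" for n using V Q by (simp add: e_def)
  have E_le: "emeasure lborel (E n) \<le> ennreal (e n)" for n
  proof -
    have "real (card (F n)) * (?V * \<epsilon> n ^ ?N) = e n"
      by (simp only: F(2) M \<epsilon>N e_def powr_diff powr_minus) (simp add: divide_inverse mult_ac)
    moreover have "emeasure lborel (E n) \<le> ennreal (real (card (F n)) * (?V * \<epsilon> n ^ ?N))"
      unfolding E_def by (rule emeasure_cluster_balls_le[OF cl])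
    ultimately show ?thesis by (simp only:)
  qed
  have Cc: "u n \<in> C_c_inf" for n
    unfolding u_def by (rule cluster_in_C_c_inf[OF cl])
  have supp: "bounded (\<Union>n. supp (u n))"
  proof (rule bounded_subset[OF bounded_cball])
    show "(\<Union>n. supp (u n)) \<subseteq> cball 0 (real ?N + 1)"
    proof
      fix x assume "x \<in> (\<Union>n. supp (u n))"
      then obtain n where "x \<in> supp (u n)" by auto
      moreover have "supp (u n) \<subseteq> E n"
        unfolding u_def E_def by (rule supp_cluster_subset[OF cl])
      ultimately have "x \<in> E n" by blast
      then obtain z where z: "z \<in> F n" "dist z x \<le> \<epsilon> n" by (auto simp: E_def)
      then have "norm z \<le> ?N" using F(3)[of n] by auto
      moreover have "norm x \<le> norm z + dist z x"
        using norm_triangle_ineq[of z "x - z"] by (simp add: dist_norm norm_minus_commute)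
      ultimately show "x \<in> cball 0 (real ?N + 1)" using z \<epsilon>1[of n] by simp
    qed
  qed
  have bdd: "bounded_in_coulomb_sobolev \<alpha> p u"
  proof -
    obtain C1 :: real where C1: "C1 \<ge> 0" "\<And>p (u :: 'a \<Rightarrow> real) E t S.
      0 < p \<Longrightarrow> u \<in> borel_measurable borel \<Longrightarrow> E \<in> sets borel \<Longrightarrow> (\<And>x. \<bar>u x\<bar> \<le> t * indicator E x) \<Longrightarrow>
      (\<And>y. (\<integral>\<^sup>+w. ennreal (norm (y - w) powr - (?N - \<alpha>)) * indicator E w \<partial>lborel) \<le> S) \<Longrightarrow>
      coulomb_energy \<alpha> p u \<le> ennreal C1 * (ennreal (t powr p))\<^sup>2 * emeasure lborel E * S"
      using coulomb_energy_le[OF \<alpha>] by blast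
    have s: "0 \<le> ?N - \<alpha>" "?N - \<alpha> < ?N" using \<alpha> by auto
    obtain C2 :: real where C2: "C2 \<ge> 0" "\<And>(y::'a) F \<epsilon> \<delta>.
      finite F \<Longrightarrow> F \<subseteq> cball 0 ?N \<Longrightarrow> 0 < \<epsilon> \<Longrightarrow> \<epsilon> \<le> \<delta> \<Longrightarrow> \<delta> \<le> 1 \<Longrightarrow>
      (\<And>z z'. z \<in> F \<Longrightarrow> z' \<in> F \<Longrightarrow> z \<noteq> z' \<Longrightarrow> 2 * \<delta> \<le> norm (z - z')) \<Longrightarrow>
      (\<integral>\<^sup>+w. ennreal (norm (y - w) powr - (?N - \<alpha>)) * indicator (\<Union>z\<in>F. cball z \<epsilon>) w \<partial>lborel)
        \<le> ennreal (C2 * (\<epsilon> powr (?N - (?N - \<alpha>)) + (\<epsilon> / \<delta>) ^ ?N))"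
      using nn_integral_dist_powr_separated_balls_le[OF s, of "real ?N"] by blast
    define K where "K = C1 * C2 * ?V * Q * (1 + 2 ^ ?N * Q)"
    have K0: "K \<ge> 0" using C1 C2 V Q by (simp add: K_def)
    have energy: "coulomb_energy \<alpha> p (u n) \<le> ennreal K" for n
    proof -
      \<comment> \<open>The two terms of \<open>S\<close> yield the self-energy and the interaction energy.\<close>
      define S where "S = C2 * (\<epsilon> n powr \<alpha> + 2 ^ ?N * Q * \<epsilon> n powr (?N - m))"
      have S0: "S \<ge> 0" using C2 Q by (simp add: S_def)
      have "(\<epsilon> n / (1 / (2 * real (k n)))) ^ ?N = 2 ^ ?N * (real (k n ^ ?N) * \<epsilon> n ^ ?N)"
        by (simp add: power_mult_distrib)
      also have "\<dots> = 2 ^ ?N * Q * \<epsilon> n powr (?N - m)"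
        by (simp only: M \<epsilon>N powr_diff powr_minus) (simp add: divide_inverse mult_ac)
      finally have ratio: "(\<epsilon> n / (1 / (2 * real (k n)))) ^ ?N = 2 ^ ?N * Q * \<epsilon> n powr (?N - m)" .
      have \<delta>: "1 / (2 * real (k n)) \<le> 1" "\<And>z z'. z \<in> F n \<Longrightarrow> z' \<in> F n \<Longrightarrow> z \<noteq> z' \<Longrightarrow> 2 * (1 / (2 * real (k n))) \<le> norm (z - z')"
        using k[of n] sep[of _ n] by (auto simp: field_simps)
      have "(\<integral>\<^sup>+w. ennreal (norm (y - w) powr - (?N - \<alpha>)) * indicator (E n) w \<partial>lborel) \<le> ennreal S" for y
        using C2(2)[OF F(1)[of n] F(3)[of n] \<epsilon>0[of n] \<epsilon>_le[of n] \<delta>] unfolding ratio by (simp add: E_def S_def)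
      then have "coulomb_energy \<alpha> p (u n) \<le> ennreal C1 * (ennreal (t n powr p))\<^sup>2 * emeasure lborel (E n) * ennreal S"
        using Cc[of n]
        by (intro C1(2) p abs_u E_borel borel_measurable_continuous_onI smooth_continuous)
           (auto simp: C_c_inf_def)
      also have "\<dots> \<le> ennreal C1 * (ennreal (t n powr p))\<^sup>2 * ennreal (e n) * ennreal S"
        by (intro mult_left_mono mult_right_mono E_le) auto
      also have "\<dots> = ennreal (C1 * (t n powr p)\<^sup>2 * e n * S)"
        using C1 e0[of n] S0 by (simp add: ennreal_mult ennreal_power)
      also have "\<dots> \<le> ennreal K"
      proof (rule ennreal_leI)
        let ?d = "\<epsilon> n"
        have "(t n powr p)\<^sup>2 = ?d powr (- (2 * p * \<tau>))"
          using \<epsilon>0[of n] by (simp add: t_def powr_powr power2_eq_square powr_add[symmetric] algebra_simps)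
        then have "C1 * (t n powr p)\<^sup>2 * e n * S = C1 * C2 * ?V * Q *
          (?d powr (- (2 * p * \<tau>)) * ?d powr (?N - m) * ?d powr \<alpha> + 2 ^ ?N * Q * (?d powr (- (2 * p * \<tau>)) * ?d powr (?N - m) * ?d powr (?N - m)))"
          by (simp add: e_def S_def algebra_simps)
        also have "?d powr (- (2 * p * \<tau>)) * ?d powr (?N - m) * ?d powr \<alpha> = ?d powr (- (2 * p * \<tau>) + (?N - m) + \<alpha>)"
          by (simp only: powr_add)
        also have "?d powr (- (2 * p * \<tau>)) * ?d powr (?N - m) * ?d powr (?N - m) = ?d powr (- (2 * p * \<tau>) + (?N - m) + (?N - m))"
          by (simp only: powr_add)
        also have "C1 * C2 * ?V * Q * (?d powr (- (2 * p * \<tau>) + (?N - m) + \<alpha>) +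
            2 ^ ?N * Q * ?d powr (- (2 * p * \<tau>) + (?N - m) + (?N - m))) \<le> C1 * C2 * ?V * Q * (1 + 2 ^ ?N * Q * 1)"
          using C1(1) C2(1) V Q self m by (intro mult_left_mono add_mono \<epsilon>_powr_le) auto
        finally show "C1 * (t n powr p)\<^sup>2 * e n * S \<le> K" by (simp add: K_def)
      qed
      finally show ?thesis .
    qed
    have ugrad: "(4 * t n / \<epsilon> n)\<^sup>2 * e n \<le> 16 * ?V * Q" for n
    proof -
      let ?d = "\<epsilon> n"
      have "t n / ?d = ?d powr (- \<tau> - 1)" using \<epsilon>0[of n] by (simp add: t_def powr_diff)
      then have "4 * t n / ?d = 4 * ?d powr (- \<tau> - 1)" by (simp only: times_divide_eq_right[symmetric])
      then have "(4 * t n / ?d)\<^sup>2 = 16 * (?d powr (- \<tau> - 1) * ?d powr (- \<tau> - 1))"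
        by (simp only: power2_eq_square)
      then have "(4 * t n / ?d)\<^sup>2 * e n = 16 * ?V * Q * (?d powr (- \<tau> - 1) * ?d powr (- \<tau> - 1) * ?d powr (?N - m))"
        by (simp add: e_def mult_ac)
      also have "?d powr (- \<tau> - 1) * ?d powr (- \<tau> - 1) * ?d powr (?N - m) = ?d powr ((- \<tau> - 1) + (- \<tau> - 1) + (?N - m))"
        by (simp only: powr_add)
      also have "16 * ?V * Q * \<dots> \<le> 16 * ?V * Q * 1"
        using V Q grad by (intro mult_left_mono \<epsilon>_powr_le) auto
      finally show ?thesis by simp
    qed
    note sob = coulomb_sobolev_norm_le[OF Cc E_borel E_le e0 _ energy K0 p]
    have g: "norm (gradient (u n) x) \<le> 4 * t n / \<epsilon> n * indicator (E n) x" for n x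
      unfolding u_def E_def by (rule norm_gradient_cluster_le[OF cl])
    have "coulomb_sobolev_norm \<alpha> p (u n) \<le> sqrt (16 * ?V * Q + K powr (1 / p))" for n
      using sob(2)[OF g, of n] ugrad[of n] by (meson order_trans real_sqrt_le_mono add_right_mono)
    then show ?thesis
      unfolding bounded_in_coulomb_sobolev_def using sob(1)[OF g] by blast
  qed
  have ae: "AE x in lebesgue. (\<lambda>n. u n x) \<longlonglongrightarrow> 0"
  proof -
    have E_leb: "E n \<in> sets lebesgue" for n using E_borel by simp
    have le: "emeasure lebesgue (E n) \<le> ennreal (e n)" for n
      using E_le[of n] E_borel[of n] by simp
    define r where "r = 2 powr (- (?N / m * (?N - m)))"
    have r: "0 < r" "r < 1"
      using m m_less powr_less_mono[of "- (?N / m * (?N - m))" 0 2] by (auto simp: r_def)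
    have er: "e n \<le> ?V * Q * r ^ n" for n
    proof -
      have kn: "real (k n) = 2 powr real n" by (simp add: k_def powr_realpow)
      have "\<epsilon> n powr (?N - m) = (1 / 2) powr (?N - m) * (real (k n) powr - (?N / m)) powr (?N - m)"
        unfolding \<epsilon>_def by (subst powr_mult) simp_all
      also have "(real (k n) powr - (?N / m)) powr (?N - m) = (2 powr real n) powr (- (?N / m) * (?N - m))"
        by (simp only: kn powr_powr mult.assoc)
      also have "(2 powr real n) powr (- (?N / m) * (?N - m)) = (2 powr (- (?N / m * (?N - m)))) powr real n"
        by (simp only: powr_powr mult_minus_left mult_minus_right mult.commute)
      also have "\<dots> = r ^ n" by (simp add: r_def powr_realpow)
      also have "(1 / 2) powr (?N - m) * r ^ n \<le> 1 * r ^ n"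
        using r m_less by (intro mult_right_mono powr_le1) auto
      finally show ?thesis using V Q by (simp add: e_def)
    qed
    have "AE x in lebesgue. eventually (\<lambda>n. x \<in> space lebesgue - E n) sequentially"
    proof (rule borel_cantelli_AE1[OF E_leb])
      show "emeasure lebesgue (E n) < \<infinity>" for n using le[of n] by (rule le_less_trans) simp
      show "summable (\<lambda>n. measure lebesgue (E n))"
      proof (rule summable_comparison_test'[where N = 0])
        show "summable (\<lambda>n. ?V * Q * r ^ n)" using r by (intro summable_mult summable_geometric) auto
        show "norm (measure lebesgue (E n)) \<le> ?V * Q * r ^ n" for n
          using er[of n] enn2real_leI[OF e0 le[of n]] by (simp add: measure_def)
      qed
    qed
    then show ?thesis
    proof (rule eventually_mono)
      fix x assume "eventually (\<lambda>n. x \<in> space lebesgue - E n) sequentially"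
      then have "eventually (\<lambda>n. u n x = 0) sequentially"
      proof (rule eventually_mono)
        fix n assume "x \<in> space lebesgue - E n"
        then show "u n x = 0" using abs_u[of n x] by simp
      qed
      then show "(\<lambda>n. u n x) \<longlonglongrightarrow> 0" by (rule tendsto_eventually)
    qed
  qed
  define c where "c = Q * ?V * (1 / 2) ^ ?N * exp (- 4 / 3) powr q"
  have c: "c > 0" using Q V by (simp add: c_def)
  have low: "ennreal c \<le> (\<integral>\<^sup>+ x. ennreal (\<bar>u n x\<bar> powr q) \<partial>lebesgue)" for n
  proof -
    let ?d = "\<epsilon> n"
    have "(t n * exp (- 4 / 3)) powr q = ?d powr (- \<tau> * q) * exp (- 4 / 3) powr q"
      using t0[of n] by (subst powr_mult) (simp_all add: t_def powr_powr)
    moreover have "(?d / 2) ^ ?N = (1 / 2) ^ ?N * ?d powr ?N"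
      by (simp only: power_divide \<epsilon>N[symmetric]) simp
    moreover have "real (card (F n)) = Q * ?d powr - m" by (simp only: F(2) M)
    ultimately have "real (card (F n)) * ((t n * exp (- 4 / 3)) powr q * (?V * (?d / 2) ^ ?N))
      = c * (?d powr - m * ?d powr (- \<tau> * q) * ?d powr ?N)"
      by (simp only: c_def mult_ac)
    also have "?d powr - m * ?d powr (- \<tau> * q) * ?d powr ?N = ?d powr (- m + - \<tau> * q + ?N)"
      by (simp only: powr_add)
    also have "- m + - \<tau> * q + ?N = 0" using norm_q by (simp add: algebra_simps)
    finally have "real (card (F n)) * ((t n * exp (- 4 / 3)) powr q * (?V * (?d / 2) ^ ?N)) = c"
      using \<epsilon>0[of n] by simp
    moreover have "ennreal (real (card (F n)) * ((t n * exp (- 4 / 3)) powr q * (?V * (?d / 2) ^ ?N)))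
      \<le> (\<integral>\<^sup>+ x. ennreal (\<bar>u n x\<bar> powr q) \<partial>lebesgue)"
      unfolding u_def by (rule nn_integral_cluster_powr_ge[OF cl q])
    ultimately show ?thesis by (simp only:)
  qed
  have "0 < ennreal c" using c by simp
  also have "ennreal c \<le> liminf (\<lambda>n. \<integral>\<^sup>+ x. ennreal (\<bar>u n x\<bar> powr q) \<partial>lebesgue)"
    by (intro Liminf_bounded always_eventually allI low)
  finally show ?thesis using Cc supp bdd ae by blast
qed

theorem lemma3p4:
  fixes \<alpha> p :: real
  assumes "CARD('n::finite) \<ge> 3"
    and "0 < \<alpha>" and "\<alpha> < real CARD('n)"
    and "p > (real CARD('n) + \<alpha>) / (real CARD('n) - 2)"
  shows "\<exists>u :: nat \<Rightarrow> real ^ 'n \<Rightarrow> real.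
    (\<forall>n. u n \<in> C_c_inf) \<and>
    bounded (\<Union>n. supp (u n)) \<and>
    bounded_in_coulomb_sobolev \<alpha> p u \<and>
    (AE x in lebesgue. (\<lambda>n. u n x) \<longlonglongrightarrow> 0) \<and>
    (\<alpha> \<le> 2 \<or> p \<le> 2 * \<alpha> / (\<alpha> - 2) \<longrightarrow>
       0 < liminf (\<lambda>n. \<integral>\<^sup>+ x. ennreal (\<bar>u n x\<bar> powr (2 * (2 * p + \<alpha>) / (2 + \<alpha>))) \<partial>lebesgue)) \<and>
    (\<alpha> > 2 \<and> p > 2 * \<alpha> / (\<alpha> - 2) \<longrightarrow>
       0 < liminf (\<lambda>n. \<integral>\<^sup>+ x. ennreal (\<bar>u n x\<bar> powr p) \<partial>lebesgue))"
proof -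
  let ?N = "real CARD('n)"
  have dim: "real DIM(real ^ 'n) = ?N" by simp
  have N: "?N - 2 > 0" using assms(1) by simp
  have \<alpha>: "0 < \<alpha>" "\<alpha> < real DIM(real ^ 'n)" using assms by simp_all
  have super: "?N + \<alpha> < p * (?N - 2)" using assms(4) N by (simp add: field_simps)
  have "1 < (?N + \<alpha>) / (?N - 2)" using N assms(2) by (simp add: field_simps)
  then have p: "1 < p" using assms(4) by linarith
  show ?thesis
  proof (cases "\<alpha> \<le> 2 \<or> p \<le> 2 * \<alpha> / (\<alpha> - 2)")
    case True
    \<comment> \<open>Equality in the conditions on the Dirichlet integral and on the self-energy forces
      \<open>\<tau> = r / 2\<close> and \<open>m = N - 2 - r\<close>.\<close>
    define r where "r = (2 + \<alpha>) / (p - 1)"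
    define q where "q = 2 * (2 * p + \<alpha>) / (2 + \<alpha>)"
    have r: "r * (p - 1) = 2 + \<alpha>" using p by (simp add: r_def)
    have "r < ?N - 2" using super p by (simp add: r_def field_simps)
    moreover have "\<alpha> - 2 \<le> r"
    proof (cases "\<alpha> \<le> 2")
      case True
      moreover have "r > 0" using p assms(2) by (simp add: r_def)
      ultimately show ?thesis by simp
    next
      case False
      with True have "p * (\<alpha> - 2) \<le> 2 * \<alpha>" by (simp add: field_simps)
      then have "(\<alpha> - 2) * (p - 1) \<le> 2 + \<alpha>" by (simp add: algebra_simps)
      then show ?thesis using p by (simp add: r_def pos_le_divide_eq)
    qed
    moreover have "q > 0" using p assms(2) by (simp add: q_def)
    moreover have "p * r = 2 + \<alpha> + r" using r by (simp add: algebra_simps)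
    moreover have "q * (r / 2) = r + 2"
    proof -
      have q: "q * (2 + \<alpha>) = 2 * (2 * p + \<alpha>)" using assms(2) by (simp add: q_def)
      have "q * (r / 2) = q * (2 + \<alpha>) / (2 * (p - 1))" by (simp add: r_def)
      also have "\<dots> = (2 * p + \<alpha>) / (p - 1)"
        unfolding q by (rule mult_divide_mult_cancel_left) simp
      also have "\<dots> = r + 2" using p by (simp add: r_def field_simps)
      finally show ?thesis .
    qed
    ultimately have "\<exists>u :: nat \<Rightarrow> real ^ 'n \<Rightarrow> real. (\<forall>n. u n \<in> C_c_inf) \<and> bounded (\<Union>n. supp (u n)) \<and>
        bounded_in_coulomb_sobolev \<alpha> p u \<and> (AE x in lebesgue. (\<lambda>n. u n x) \<longlonglongrightarrow> 0) \<and>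
        0 < liminf (\<lambda>n. \<integral>\<^sup>+ x. ennreal (\<bar>u n x\<bar> powr q) \<partial>lebesgue)"
      using p unfolding dim[symmetric]
      by (intro concentrating_sequence_exists[OF \<alpha>, where m = "real DIM(real ^ 'n) - 2 - r" and \<tau> = "r / 2"])
         (simp_all add: add_divide_distrib)
    then show ?thesis using True unfolding q_def by (metis linorder_not_less)
  next
    case False
    then have \<alpha>2: "\<alpha> > 2" and p2: "p * (\<alpha> - 2) > 2 * \<alpha>" by (auto simp: field_simps)
    \<comment> \<open>With \<open>m = N - \<alpha>\<close> and \<open>\<tau> = \<alpha> / p\<close> this is the condition on the Dirichlet integral.\<close>
    have "2 * (\<alpha> / p) + 2 \<le> \<alpha>" using p2 p by (simp add: field_simps)
    then have "\<exists>u :: nat \<Rightarrow> real ^ 'n \<Rightarrow> real. (\<forall>n. u n \<in> C_c_inf) \<and> bounded (\<Union>n. supp (u n)) \<and>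
        bounded_in_coulomb_sobolev \<alpha> p u \<and> (AE x in lebesgue. (\<lambda>n. u n x) \<longlonglongrightarrow> 0) \<and>
        0 < liminf (\<lambda>n. \<integral>\<^sup>+ x. ennreal (\<bar>u n x\<bar> powr p) \<partial>lebesgue)"
      using p \<alpha>
      by (intro concentrating_sequence_exists[OF \<alpha>, where m = "real DIM(real ^ 'n) - \<alpha>" and \<tau> = "\<alpha> / p"]) simp_all
    then show ?thesis using False by blast
  qed
qed

end
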